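(* For each sufficiently large $x$ let $\mathcal{Q}_x\subseteq[1,x]\cap\mathbb{N}$ be a set of distinct moduli for which there exist pairwise disjoint residue classes $a_q\pmod q$, $q\in\mathcal{Q}_x$. Suppose that, as $x\to\infty$, $$|\mathcal{Q}_x|=xL(x)^{-1+o(1)}.$$ Then, as $x\to\infty$, $$\max_{\substack{q,q'\in\mathcal{Q}_x\\ q\ne q'}}\gcd(q,q')\ \ge\ xL(x)^{-1+o(1)}.$$ Moreover, there exist distinct $q,q'\in\mathcal{Q}_x$ and positive integers $g,u,v$ such that $$q=gu,\qquad q'=gv,\qquad \gcd(u,v)=1,$$ and $$g\ge xL(x)^{-1+o(1)},\qquad \max\{u,v\}\le L(x)^{1+o(1)}.$$ In particular, these conclusions hold for every extremal family, that is, whenever $|\mathcal{Q}_x|=f(x)$ (with $\mathcal{Q}_x\subseteq[2,x]$).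
   Context: $L(x):=\exp\left(\sqrt{\log x\,\log\log x}\right)$. The function $f(x)$ is the largest size $k$ of a family of pairwise disjoint residue classes $a_1\pmod{m_1},\dots,a_k\pmod{m_k}$ whose moduli are integers satisfying $2\le m_1<\cdots<m_k\le x$. The residue class $a\pmod m$ is the set $\{n\in\mathbb{Z}:n\equiv a\pmod m\}$. All $o(1)$ terms denote quantities tending to $0$ as $x\to\infty$: e.g. $|\mathcal{Q}_x|=xL(x)^{-1+o(1)}$ means $|\mathcal{Q}_x|=xL(x)^{-1+\delta(x)}$ for some $\delta(x)\to0$, and an inequality such as $g\ge xL(x)^{-1+o(1)}$ means $g\ge xL(x)^{-1+\delta'(x)}$ for some $\delta'(x)\to0$. *)

theory Defs
  imports Complex_Main "HOL-Number_Theory.Cong" "HOL-Library.Disjoint_Sets"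
begin

definition L :: "real \<Rightarrow> real" where
  "L x = exp (sqrt (ln x * ln (ln x)))"

definition residue_class :: "int \<Rightarrow> nat \<Rightarrow> int set" where
  "residue_class a m = {n. [n = a] (mod int m)}"

definition admits_disjoint_classes :: "nat set \<Rightarrow> bool" where
  "admits_disjoint_classes M \<longleftrightarrow>
     (\<exists>a :: nat \<Rightarrow> int. disjoint_family_on (\<lambda>m. residue_class (a m) m) M)"

definition max_disjoint_classes :: "real \<Rightarrow> nat" where
  "max_disjoint_classes x =
     Max {card M | M. M \<subseteq> {m. 2 \<le> m \<and> real m \<le> x} \<and> admits_disjoint_classes M}"

text \<open>The maximum above is attained: the empty family is always a candidate, and all
  candidates are subsets of one finite set.\<close>

lemma max_disjoint_classes_wf:
  shows "finite {card M | M. M \<subseteq> {m. 2 \<le> m \<and> real m \<le> x} \<and> admits_disjoint_classes M}"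
    and "{card M | M. M \<subseteq> {m. 2 \<le> m \<and> real m \<le> x} \<and> admits_disjoint_classes M} \<noteq> {}"
proof -
  have "{m. 2 \<le> m \<and> real m \<le> x} \<subseteq> {..nat \<lfloor>x\<rfloor>}"
    by (auto simp: le_nat_floor)
  then have "finite {m. 2 \<le> m \<and> real m \<le> x}"
    using finite_subset by blast
  then have "finite (card ` Pow {m. 2 \<le> m \<and> real m \<le> x})"
    by simp
  then show "finite {card M | M. M \<subseteq> {m. 2 \<le> m \<and> real m \<le> x} \<and> admits_disjoint_classes M}"
    by (rule rev_finite_subset) auto
  have "admits_disjoint_classes {}"
    by (simp add: admits_disjoint_classes_def disjoint_family_on_def)
  then show "{card M | M. M \<subseteq> {m. 2 \<le> m \<and> real m \<le> x} \<and> admits_disjoint_classes M} \<noteq> {}"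
    by blast
qed

text \<open>In the two predicates below each \<open>\<delta>\<close> is the \<open>o(1)\<close> term of one estimate; it may
  depend on the whole family \<open>Q\<close>. The maximum is over a finite set, nonempty as soon as
  \<open>Q x\<close> is a finite set with at least two elements.\<close>

definition large_max_gcd :: "(real \<Rightarrow> nat set) \<Rightarrow> bool" where
  "large_max_gcd Q \<longleftrightarrow>
     (\<exists>\<delta> :: real \<Rightarrow> real. (\<delta> \<longlongrightarrow> 0) at_top \<and>
       (\<forall>\<^sub>F x in at_top.
          real (Max {gcd q q' | q q'. q \<in> Q x \<and> q' \<in> Q x \<and> q \<noteq> q'})
            \<ge> x * L x powr (-1 + \<delta> x)))"

definition has_close_pair :: "(real \<Rightarrow> nat set) \<Rightarrow> bool" where
  "has_close_pair Q \<longleftrightarrow>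
     (\<exists>\<delta>\<^sub>1 \<delta>\<^sub>2 :: real \<Rightarrow> real. (\<delta>\<^sub>1 \<longlongrightarrow> 0) at_top \<and> (\<delta>\<^sub>2 \<longlongrightarrow> 0) at_top \<and>
       (\<forall>\<^sub>F x in at_top.
          \<exists>q \<in> Q x. \<exists>q' \<in> Q x. \<exists>g u v :: nat.
            q \<noteq> q' \<and> g > 0 \<and> u > 0 \<and> v > 0 \<and>
            q = g * u \<and> q' = g * v \<and> gcd u v = 1 \<and>
            real g \<ge> x * L x powr (-1 + \<delta>\<^sub>1 x) \<and>
            real (max u v) \<le> L x powr (1 + \<delta>\<^sub>2 x)))"

end

theory Submission
  imports Defs "HOL-Number_Theory.Number_Theory" "HOL-Real_Asymp.Real_Asymp"
begin

text \<open>Disjointness of \<open>a\<^sub>q\<close> mod \<open>q\<close> and \<open>a\<^sub>r\<close> mod \<open>r\<close> means \<open>a\<^sub>q \<noteq> a\<^sub>r\<close> modulo \<open>gcd q r\<close>. If all these gcds are at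
  most \<open>D\<close> and every modulus has at most \<open>w\<close> prime factors, then there are at most \<open>D R\<^sup>w\<close> moduli, with
  \<open>R\<close> polylogarithmic in \<open>w\<close>: otherwise some unitary divisor \<open>d\<close> and residue class modulo \<open>d\<close> single out a
  subfamily whose cofactors \<open>q / d\<close> have spread sets of primes, and the spread lemma behind the
  Alweiss-Lovasz-Wu-Zhang sunflower bound yields two coprime cofactors, contradicting disjointness.
  All but \<open>x / L(x)\<^sup>2\<close> of the integers up to \<open>x\<close> have \<open>O(sqrt (ln x / ln (ln x)))\<close> prime factors, for which
  \<open>R\<^sup>w = L(x)\<^bsup>o(1)\<^esup>\<close>, so \<open>D\<close> is at least \<open>|Q| L(x)\<^bsup>-o(1)\<^esup>\<close>.

  Extremal families have at least \<open>x L(x)\<^bsup>-1-o(1)\<^esup>\<close> members because of the moduli \<open>p\<^sub>1 \<cdots> p\<^sub>K\<close> with \<open>p\<^sub>i\<close>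
  just below \<open>\<rho>\<^sup>i\<close>, where \<open>K\<close> is close to \<open>2 sqrt (ln x / ln (ln x))\<close> and the residue modulo \<open>p\<^sub>i\<close> encodes
  \<open>p\<^bsub>i+1\<^esub>\<close>.\<close>

section \<open>Two disjoint members of a spread family\<close>

text \<open>The quality of the spread bound decides the result. Put l = sqrt (ln x * ln (ln x)) and
  s = sqrt (ln x / ln (ln x)), so l = s * ln (ln x). The number w of prime factors is of order s.
  The classical Erdos-Rado sunflower bound, of order w^w, would cost exp(c * l) with a fixed c > 0,
  a positive power of L(x). A base polylogarithmic in w is a power of ln (ln x) and costs only
  exp(O(s * ln (ln (ln x)))) = L(x)^o(1). The constant 2 in K also comes from a balance. With K
  factors, ln rho is about 2 * ln x / K^2. A block just below rho^K contains the rho^(K-1) or so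
  primes that can be encoded only if rho is at least of the order of ln (rho^K), which is that of l.
  So ln rho has to stay slightly above ln (ln x) / 2, that is, K slightly below 2 * s. The family
  then loses a factor of about rho^K = exp(2 * ln x / K) = L(x)^(1+o(1)) against x.\<close>

definition recolour :: "nat \<Rightarrow> 'a set \<Rightarrow> ('a \<Rightarrow> nat) \<Rightarrow> 'a \<Rightarrow> nat" where
  "recolour j F c = (\<lambda>x. if x \<in> F then j else c x)"

text \<open>Stage \<open>j\<close> replaces \<open>T c q\<close> by a minimal set \<open>T' c q\<close> of the form \<open>T c r - W\<close>, where \<open>W\<close> is colour
  class \<open>j\<close> and \<open>T c r \<subseteq> T c q \<union> W\<close>. Few pairs \<open>(c, q)\<close> have a large \<open>F = T' c q\<close>: give \<open>F\<close> the
  colour \<open>j\<close>; the new colouring determines a set \<open>T c r\<close> inside its class \<open>j\<close>, and minimality forces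
  \<open>F \<subseteq> T c r\<close>. So the new colouring, a subset of a small set, the colours lost on \<open>F\<close> and
  a member containing \<open>F\<close> encode \<open>(c, q)\<close>, and spreadness bounds the number of the latter.\<close>

lemma fragment_step:
  fixes G :: "'i set" and X :: "'a set" and k :: nat and T :: "('a \<Rightarrow> nat) \<Rightarrow> 'i \<Rightarrow> 'a set"
  defines "C \<equiv> X \<rightarrow>\<^sub>E {..<k}"
  assumes fin: "finite G" "finite X" and j: "j < k" and n: "n \<ge> 1"
    and kR: "4 * real k \<le> R" "R > 0"
    and SX: "\<forall>q\<in>G. S q \<subseteq> X"
    and spread: "\<forall>E. E \<noteq> {} \<longrightarrow> E \<subseteq> X \<longrightarrow>
       real (card {q\<in>G. E \<subseteq> S q}) * R ^ card E \<le> real (card G)"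
    and T: "\<forall>c\<in>C. \<forall>q\<in>G. T c q \<subseteq> S q"
      "\<forall>c\<in>C. \<forall>q\<in>G. \<forall>x\<in>T c q. \<not> c x < j"
      "\<forall>c\<in>C. \<forall>c'\<in>C. \<forall>q\<in>G. (\<forall>x\<in>X. c x < j \<or> c' x < j \<longrightarrow> c x = c' x) \<longrightarrow> T c q = T c' q"
      "\<forall>c\<in>C. \<forall>q\<in>G. \<exists>q'\<in>G. S q' \<subseteq> T c q \<union> {x. c x < j}"
  shows "\<exists>T'. (\<forall>c\<in>C. \<forall>q\<in>G. T' c q \<subseteq> S q) \<and>
      (\<forall>c\<in>C. \<forall>q\<in>G. \<forall>x\<in>T' c q. \<not> c x < Suc j) \<and>
      (\<forall>c\<in>C. \<forall>c'\<in>C. \<forall>q\<in>G. (\<forall>x\<in>X. c x < Suc j \<or> c' x < Suc j \<longrightarrow> c x = c' x) \<longrightarrow> T' c q = T' c' q) \<and>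
      (\<forall>c\<in>C. \<forall>q\<in>G. \<exists>q'\<in>G. S q' \<subseteq> T' c q \<union> {x. c x < Suc j}) \<and>
      real (card {(c, q) \<in> C \<times> G. card (T c q) < 2 * n \<and> card (T' c q) \<ge> n})
        \<le> real (card C) * real (card G) * (4 * real k / R)"
proof -
  note SX = SX[rule_format] and spread = spread[rule_format] and TS = T(1)[rule_format] and Tnew = T(2)[rule_format] and Tdep = T(3)[rule_format]
    and Tcov = T(4)[rule_format]
  define W where "W c = {x\<in>X. c x = j}" for c :: "'a \<Rightarrow> nat"
  define A where "A c q = {r\<in>G. card (T c r) < 2 * n \<and> T c r \<subseteq> T c q \<union> W c}" for c q
  \<comment> \<open>For a large \<open>T c q\<close> the choice is \<open>q\<close> itself. Such
    pairs are not counted, but \<open>T'\<close> must satisfy the invariants for them too.\<close>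
  define pick where "pick c q = (if card (T c q) < 2 * n then
      arg_min_on (\<lambda>r. card (T c r - W c)) (A c q) else q)" for c q
  define T' where "T' c q = T c (pick c q) - W c" for c q
  have finC: "finite C" unfolding C_def using fin by (simp add: finite_PiE)
  have finA: "finite (A c q)" for c q unfolding A_def using fin by simp
  have Aq: "q \<in> A c q" if "q \<in> G" "card (T c q) < 2 * n" for c q
    using that by (auto simp: A_def)
  have pickA: "pick c q \<in> A c q"
    and pickmin: "\<And>r. r \<in> A c q \<Longrightarrow> card (T c (pick c q) - W c) \<le> card (T c r - W c)"
    if "q \<in> G" "card (T c q) < 2 * n" for c q
    using arg_min_if_finite(1)[OF finA, of c q "\<lambda>r. card (T c r - W c)"]
      arg_min_least[OF finA, of c q _ "\<lambda>r. card (T c r - W c)"] Aq[OF that] that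
    by (auto simp: pick_def)
  have pickG: "pick c q \<in> G" if "q \<in> G" for c q
    using pickA[OF that] that by (cases "card (T c q) < 2 * n") (auto simp: A_def pick_def)
  have T'T: "T' c q \<subseteq> T c q" if "q \<in> G" for c q
    using pickA[OF that, of c] that unfolding T'_def
    by (cases "card (T c q) < 2 * n") (auto simp: A_def pick_def)
  have P1: "\<forall>c\<in>C. \<forall>q\<in>G. T' c q \<subseteq> S q" using T'T TS by blast
  have P2: "\<forall>c\<in>C. \<forall>q\<in>G. \<forall>x\<in>T' c q. \<not> c x < Suc j"
  proof (intro ballI notI)
    fix c q x assume *: "c \<in> C" "q \<in> G" "x \<in> T' c q" "c x < Suc j"
    have "x \<in> T c q" using T'T[OF *(2)] *(3) by (rule subsetD)
    moreover from this have "x \<in> X" using TS[OF *(1,2)] SX[OF *(2)] by (meson subsetD)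
    ultimately have "x \<in> T c q" "x \<in> X" .
    with * Tnew[of c q x] have "c x = j" by simp
    then show False using * \<open>x \<in> X\<close> by (simp add: T'_def W_def)
  qed
  have P3: "T' c q = T' c' q" if cc: "c \<in> C" "c' \<in> C" and "q \<in> G"
      and eq: "\<forall>x\<in>X. c x < Suc j \<or> c' x < Suc j \<longrightarrow> c x = c' x" for c c' q
  proof -
    have TT: "T c r = T c' r" if r: "r \<in> G" for r
    proof (rule Tdep[OF cc r])
      fix x assume "x \<in> X" "c x < j \<or> c' x < j"
      with eq show "c x = c' x" by (meson less_SucI)
    qed
    have WW: "W c = W c'" using eq unfolding W_def by (metis lessI)
    have AA: "A c q = A c' q" unfolding A_def using TT WW \<open>q \<in> G\<close> by auto
    have "pick c q = pick c' q"
    proof (cases "card (T c q) < 2 * n")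
      case True
      have "arg_min_on (\<lambda>r. card (T c r - W c)) (A c q) = arg_min_on (\<lambda>r. card (T c' r - W c')) (A c' q)"
        unfolding arg_min_on_def arg_min_def is_arg_min_def AA WW
        using TT by (intro arg_cong[where f=Eps] ext) (auto simp: A_def)
      then show ?thesis using True TT \<open>q \<in> G\<close> by (simp add: pick_def)
    qed (use TT \<open>q \<in> G\<close> in \<open>simp add: pick_def\<close>)
    then show ?thesis unfolding T'_def using WW TT pickG[OF \<open>q \<in> G\<close>] by metis
  qed
  have P4: "\<forall>c\<in>C. \<forall>q\<in>G. \<exists>q'\<in>G. S q' \<subseteq> T' c q \<union> {x. c x < Suc j}"
  proof (intro ballI)
    fix c q assume *: "c \<in> C" "q \<in> G"
    obtain q' where "q' \<in> G" "S q' \<subseteq> T c (pick c q) \<union> {x. c x < j}"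
      using Tcov[OF *(1) pickG[OF *(2)]] by blast
    then show "\<exists>q'\<in>G. S q' \<subseteq> T' c q \<union> {x. c x < Suc j}"
      by (intro bexI[of _ q']) (auto simp: T'_def W_def)
  qed
  define B where "B = {(c, q) \<in> C \<times> G. card (T c q) < 2 * n \<and> card (T' c q) \<ge> n}"
  \<comment> \<open>\<open>\<sigma>\<close> sees only the colouring it is applied to, so from the
    recoloured \<open>c\<close> a decoder can compute it without knowing the original
    \<open>c\<close> or \<open>q\<close>.\<close>
  define \<sigma> where "\<sigma> c = (SOME r. r \<in> G \<and> card (T c r) < 2 * n \<and> T c r \<subseteq> W c)" for c
  \<comment> \<open>The default \<open>{}\<close> keeps \<open>card (U c) < 2 * n\<close> for every
    colouring, including those that do not arise from recolouring. It contributes no code, since a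
    code needs a subset of size at least \<open>n\<close>.\<close>
  define U where "U c = (if \<sigma> c \<in> G \<and> card (T c (\<sigma> c)) < 2 * n then T c (\<sigma> c) else {})" for c
  define Code where "Code = (SIGMA c:C. SIGMA F:{F \<in> Pow (U c). card F \<ge> n}.
      (F \<rightarrow>\<^sub>E {..<k}) \<times> {q\<in>G. F \<subseteq> S q})"
  define enc where "enc = (\<lambda>(c, q). (recolour j (T' c q) c, T' c q, restrict c (T' c q), q))"
  have TX: "T c q \<subseteq> X" if "c \<in> C" "q \<in> G" for c q
    using TS[OF that] SX[OF that(2)] by (rule subset_trans)
  have finT: "finite (T c q)" if "c \<in> C" "q \<in> G" for c q
    using TS[OF that] SX[OF that(2)] fin(2) by (meson finite_subset)
  have UX: "U c \<subseteq> X" "finite (U c)" "card (U c) < 2 * n" if "c \<in> C" for c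
  proof -
    have "U c \<subseteq> X \<and> finite (U c) \<and> card (U c) < 2 * n"
    proof (cases "\<sigma> c \<in> G \<and> card (T c (\<sigma> c)) < 2 * n")
      case True
      then have "U c = T c (\<sigma> c)" unfolding U_def by (rule if_P)
      moreover have "\<sigma> c \<in> G" using True by simp
      ultimately show ?thesis
        using True TX[OF that] finT[OF that] by simp
    next
      case False
      then have "U c = {}" unfolding U_def by (rule if_not_P)
      then show ?thesis using n by simp
    qed
    then show "U c \<subseteq> X" "finite (U c)" "card (U c) < 2 * n" by simp_all
  qed
  have enc: "enc ` B \<subseteq> Code"
  proof (rule image_subsetI, clarify)
    fix c q assume "(c, q) \<in> B"
    then have c: "c \<in> C" and q: "q \<in> G" and s: "card (T c q) < 2 * n" and b: "card (T' c q) \<ge> n"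
      by (auto simp: B_def)
    define F where "F = T' c q"
    define c' where "c' = recolour j F c"
    have FX: "F \<subseteq> X" "F \<subseteq> S q" "F \<subseteq> T c q" 
      using T'T[OF q, of c] TS[OF c q] SX[OF q] unfolding F_def by (meson order_trans)+
    have c'C: "c' \<in> C" using c j FX unfolding C_def c'_def recolour_def by (auto simp: PiE_iff extensional_def)
    have Fnew: "\<not> c x < j" if "x \<in> F" for x using Tnew[OF c q subsetD[OF FX(3) that]] .
    have TT: "T c' r = T c r" if "r \<in> G" for r
      using Fnew by (intro Tdep[OF c'C c that]) (auto simp: c'_def recolour_def)
    have WW: "W c' = W c \<union> F" using FX by (auto simp: W_def c'_def recolour_def)
    have "\<exists>r. r \<in> G \<and> card (T c' r) < 2 * n \<and> T c' r \<subseteq> W c'"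
      using pickA[OF q s] TT pickG[OF q] unfolding A_def WW
      by (intro exI[of _ "pick c q"]) (auto simp: F_def T'_def)
    then have sg: "\<sigma> c' \<in> G \<and> card (T c' (\<sigma> c')) < 2 * n \<and> T c' (\<sigma> c') \<subseteq> W c'"
      unfolding \<sigma>_def by (rule someI_ex)
    then have sA: "\<sigma> c' \<in> A c q" using TT WW FX unfolding A_def by auto
    have sub: "T c (\<sigma> c') - W c \<subseteq> F" using sg TT WW by auto
    have "card F \<le> card (T c (\<sigma> c') - W c)" using pickmin[OF q s sA] by (simp add: F_def T'_def)
    then have "T c (\<sigma> c') - W c = F"
      using sub FX fin(2) by (meson card_seteq finite_subset)
    then have FU: "F \<subseteq> U c'" using sg TT by (auto simp: U_def)
    have "restrict c F \<in> F \<rightarrow>\<^sub>E {..<k}" using c FX unfolding C_def by auto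
    moreover have "enc (c, q) = (c', F, restrict c F, q)"
      by (simp add: enc_def F_def c'_def)
    ultimately show "enc (c, q) \<in> Code"
      using c'C FU b[folded F_def] q FX(2) unfolding Code_def by simp
  qed
  have inj: "inj_on enc B"
  proof (rule inj_onI, clarify)
    fix c q c2 q2 assume *: "(c, q) \<in> B" "(c2, q2) \<in> B" and e: "enc (c, q) = enc (c2, q2)"
    then have qq: "q = q2" and F: "T' c q = T' c2 q2" and r: "restrict c (T' c q) = restrict c2 (T' c q)"
      and rc: "recolour j (T' c q) c = recolour j (T' c q) c2"
      by (auto simp: enc_def)
    have "c x = c2 x" for x
      using fun_cong[OF r, of x] fun_cong[OF rc, of x] by (cases "x \<in> T' c q") (auto simp: recolour_def)
    then show "c = c2 \<and> q = q2" using qq by auto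
  qed
  have sub_bound: "real (card ((F \<rightarrow>\<^sub>E {..<k}) \<times> {q\<in>G. F \<subseteq> S q})) \<le> (real k / R) ^ n * card G"
    if "c \<in> C" "F \<subseteq> U c" "card F \<ge> n" for c F
  proof -
    have F: "finite F" "F \<subseteq> X" "F \<noteq> {}" using that UX[OF that(1)] n by (auto intro: finite_subset)
    have "real (card ((F \<rightarrow>\<^sub>E {..<k}) \<times> {q\<in>G. F \<subseteq> S q})) = real k ^ card F * card {q\<in>G. F \<subseteq> S q}"
      using F by (simp add: card_cartesian_product card_PiE)
    also have "\<dots> = (real k / R) ^ card F * (card {q\<in>G. F \<subseteq> S q} * R ^ card F)"
      using kR by (simp add: power_divide)
    also have "\<dots> \<le> (real k / R) ^ card F * card G"
      using spread[OF F(3,2)] kR by (intro mult_left_mono) auto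
    also have "\<dots> \<le> (real k / R) ^ n * card G"
      using that kR by (intro mult_right_mono power_decreasing) (auto simp: divide_simps)
    finally show ?thesis .
  qed
  have finF: "finite {F \<in> Pow (U c). card F \<ge> n}" if "c \<in> C" for c
    using UX(2)[OF that] by simp
  have finP: "finite ((F \<rightarrow>\<^sub>E {..<k}) \<times> {q\<in>G. F \<subseteq> S q})"
    if "c \<in> C" "F \<subseteq> U c" for c F
    using finite_subset[OF that(2) UX(2)[OF that(1)]] fin(1)
    by (intro finite_cartesian_product finite_PiE) auto
  have finI: "finite (SIGMA F:{F \<in> Pow (U c). card F \<ge> n}. (F \<rightarrow>\<^sub>E {..<k}) \<times> {q\<in>G. F \<subseteq> S q})"
    if "c \<in> C" for c
    by (rule finite_SigmaI[OF finF[OF that]]) (use finP[OF that] in simp)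
  have finCode: "finite Code"
    unfolding Code_def by (rule finite_SigmaI[OF finC finI])
  have cB: "card B \<le> card Code" by (rule card_inj_on_le[OF inj enc finCode])
  have "card Code = (\<Sum>c\<in>C. card (SIGMA F:{F \<in> Pow (U c). card F \<ge> n}.
      (F \<rightarrow>\<^sub>E {..<k}) \<times> {q\<in>G. F \<subseteq> S q}))"
    unfolding Code_def using finC finI by (intro card_SigmaI ballI)
  also have "\<dots> = (\<Sum>c\<in>C. \<Sum>F\<in>{F \<in> Pow (U c). card F \<ge> n}.
      card ((F \<rightarrow>\<^sub>E {..<k}) \<times> {q\<in>G. F \<subseteq> S q}))"
  proof (rule sum.cong[OF refl])
    fix c assume c: "c \<in> C"
    show "card (SIGMA F:{F \<in> Pow (U c). card F \<ge> n}. (F \<rightarrow>\<^sub>E {..<k}) \<times> {q\<in>G. F \<subseteq> S q}) =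
      (\<Sum>F\<in>{F \<in> Pow (U c). card F \<ge> n}. card ((F \<rightarrow>\<^sub>E {..<k}) \<times> {q\<in>G. F \<subseteq> S q}))"
      using finF[OF c] finP[OF c] by (intro card_SigmaI ballI) blast+
  qed
  finally have "real (card Code) = (\<Sum>c\<in>C. \<Sum>F\<in>{F \<in> Pow (U c). card F \<ge> n}.
      real (card ((F \<rightarrow>\<^sub>E {..<k}) \<times> {q\<in>G. F \<subseteq> S q})))"
    by simp
  also have "\<dots> \<le> (\<Sum>c\<in>C. \<Sum>F\<in>{F \<in> Pow (U c). card F \<ge> n}. (real k / R) ^ n * card G)"
    by (intro sum_mono sub_bound) auto
  \<comment> \<open>\<open>U c\<close> has fewer than \<open>2 * n\<close> elements, hence at most
    4^n subsets. This is the 4 in \<open>4 * real k / R\<close>; the \<open>k\<close> pays for the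
    lost colours and the \<open>R\<close> is gained from spreadness.\<close>
  also have "\<dots> \<le> (\<Sum>c\<in>C. 4 ^ n * ((real k / R) ^ n * card G))"
  proof (rule sum_mono)
    fix c assume c: "c \<in> C"
    have "card {F \<in> Pow (U c). card F \<ge> n} \<le> card (Pow (U c))" using UX[OF c] by (intro card_mono) auto
    also have "\<dots> \<le> 2 ^ (2 * n)" using UX[OF c] by (simp add: card_Pow power_increasing)
    also have "\<dots> = 4 ^ n" by (simp add: power_mult)
    finally have "real (card {F \<in> Pow (U c). card F \<ge> n}) \<le> 4 ^ n"
      by (metis of_nat_le_iff of_nat_numeral of_nat_power)
    then show "(\<Sum>F\<in>{F \<in> Pow (U c). card F \<ge> n}. (real k / R) ^ n * card G) \<le> 4 ^ n * ((real k / R) ^ n * card G)"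
      using kR by (simp add: mult_right_mono)
  qed
  also have "\<dots> = card C * card G * (4 * real k / R) ^ n"
    by (simp add: power_divide power_mult_distrib)
  also have "\<dots> \<le> card C * card G * (4 * real k / R) ^ 1"
    using kR n by (intro mult_left_mono power_decreasing) auto
  finally have "real (card B) \<le> real (card C) * real (card G) * (4 * real k / R)"
    using cB by simp
  then have P5: "real (card {(c, q) \<in> C \<times> G. card (T c q) < 2 * n \<and> card (T' c q) \<ge> n})
        \<le> real (card C) * real (card G) * (4 * real k / R)" unfolding B_def .
  show ?thesis
  proof (intro exI[of _ T'] conjI)
    show "\<forall>c\<in>C. \<forall>c'\<in>C. \<forall>q\<in>G.
        (\<forall>x\<in>X. c x < Suc j \<or> c' x < Suc j \<longrightarrow> c x = c' x) \<longrightarrow> T' c q = T' c' q"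
      by (intro ballI impI, rule P3) blast+
  qed (fact P1 P2 P4 P5)+
qed

text \<open>Each stage halves the size allowed to a fragment and adds one share
  \<open>4 * real k / R\<close> of exceptional pairs. At \<open>j = J\<close> the threshold is 1, so
  outside the exceptional pairs the fragment is empty and the first \<open>J\<close> colour classes
  cover a member.\<close>

lemma fragment_iterate:
  fixes G :: "'i set" and X :: "'a set" and k :: nat
  defines "C \<equiv> X \<rightarrow>\<^sub>E {..<k}"
  assumes fin: "finite G" "finite X" and kR: "4 * real k \<le> R" "R > 0"
    and SX: "\<forall>q\<in>G. S q \<subseteq> X"
    and small: "\<forall>q\<in>G. card (S q) < 2 ^ J"
    and spread: "\<forall>E. E \<noteq> {} \<longrightarrow> E \<subseteq> X \<longrightarrow>
       real (card {q\<in>G. E \<subseteq> S q}) * R ^ card E \<le> real (card G)"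
    and j: "j \<le> J" "j \<le> k"
  shows "\<exists>T. (\<forall>c\<in>C. \<forall>q\<in>G. T c q \<subseteq> S q) \<and>
      (\<forall>c\<in>C. \<forall>q\<in>G. \<forall>x\<in>T c q. \<not> c x < j) \<and>
      (\<forall>c\<in>C. \<forall>c'\<in>C. \<forall>q\<in>G. (\<forall>x\<in>X. c x < j \<or> c' x < j \<longrightarrow> c x = c' x) \<longrightarrow> T c q = T c' q) \<and>
      (\<forall>c\<in>C. \<forall>q\<in>G. \<exists>q'\<in>G. S q' \<subseteq> T c q \<union> {x. c x < j}) \<and>
      real (card {(c, q) \<in> C \<times> G. card (T c q) \<ge> 2 ^ (J - j)})
        \<le> j * (real (card C) * real (card G) * (4 * real k / R))"
  using j
proof (induction j)
  case 0
  have e: "{(c, q) \<in> C \<times> G. card (S q) \<ge> 2 ^ (J - 0)} = {}"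
    using small by (auto simp: not_le)
  show ?case
  proof (intro exI[of _ "\<lambda>c q. S q"] conjI)
    show "real (card {(c, q) \<in> C \<times> G. card (S q) \<ge> 2 ^ (J - 0)})
        \<le> real 0 * (real (card C) * real (card G) * (4 * real k / R))"
      unfolding e by simp
  qed auto
next
  case (Suc j)
  have finC: "finite C" unfolding C_def using fin by (simp add: finite_PiE)
  obtain T where T: "\<forall>c\<in>C. \<forall>q\<in>G. T c q \<subseteq> S q"
      "\<forall>c\<in>C. \<forall>q\<in>G. \<forall>x\<in>T c q. \<not> c x < j"
      "\<forall>c\<in>C. \<forall>c'\<in>C. \<forall>q\<in>G. (\<forall>x\<in>X. c x < j \<or> c' x < j \<longrightarrow> c x = c' x) \<longrightarrow> T c q = T c' q"
      "\<forall>c\<in>C. \<forall>q\<in>G. \<exists>q'\<in>G. S q' \<subseteq> T c q \<union> {x. c x < j}"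
    and Tb: "real (card {(c, q) \<in> C \<times> G. card (T c q) \<ge> 2 ^ (J - j)})
        \<le> j * (real (card C) * real (card G) * (4 * real k / R))"
    using Suc.IH[OF Suc_leD Suc_leD, OF Suc.prems] by (elim exE conjE) (rule that)
  define n :: nat where "n = 2 ^ (J - Suc j)"
  have n: "n \<ge> 1" and n2: "2 ^ (J - j) = 2 * n"
    using Suc.prems by (auto simp: n_def Suc_diff_Suc simp flip: power_Suc)
  have jk: "j < k" using Suc.prems by simp
  obtain T' where T': "\<forall>c\<in>C. \<forall>q\<in>G. T' c q \<subseteq> S q"
      "\<forall>c\<in>C. \<forall>q\<in>G. \<forall>x\<in>T' c q. \<not> c x < Suc j"
      "\<forall>c\<in>C. \<forall>c'\<in>C. \<forall>q\<in>G. (\<forall>x\<in>X. c x < Suc j \<or> c' x < Suc j \<longrightarrow> c x = c' x) \<longrightarrow> T' c q = T' c' q"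
      "\<forall>c\<in>C. \<forall>q\<in>G. \<exists>q'\<in>G. S q' \<subseteq> T' c q \<union> {x. c x < Suc j}"
    and Tb': "real (card {(c, q) \<in> C \<times> G. card (T c q) < 2 * n \<and> card (T' c q) \<ge> n})
        \<le> real (card C) * real (card G) * (4 * real k / R)"
    using fragment_step[of G X j k n R S T, folded C_def, OF fin jk n kR SX spread T]
    by (elim exE conjE) (rule that)
  have "card {(c, q) \<in> C \<times> G. card (T' c q) \<ge> n}
     \<le> card ({(c, q) \<in> C \<times> G. card (T c q) \<ge> 2 ^ (J - j)} \<union>
         {(c, q) \<in> C \<times> G. card (T c q) < 2 * n \<and> card (T' c q) \<ge> n})"
    unfolding n2 by (rule card_mono, rule finite_subset[OF _ finite_cartesian_product[OF finC fin(1)]]) auto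
  also have "\<dots> \<le> card {(c, q) \<in> C \<times> G. card (T c q) \<ge> 2 ^ (J - j)} +
     card {(c, q) \<in> C \<times> G. card (T c q) < 2 * n \<and> card (T' c q) \<ge> n}"
    by (rule card_Un_le)
  finally have "real (card {(c, q) \<in> C \<times> G. card (T' c q) \<ge> n})
     \<le> real (card {(c, q) \<in> C \<times> G. card (T c q) \<ge> 2 ^ (J - j)}) +
        real (card {(c, q) \<in> C \<times> G. card (T c q) < 2 * n \<and> card (T' c q) \<ge> n})"
    by (simp flip: of_nat_add)
  then have Tb'': "real (card {(c, q) \<in> C \<times> G. card (T' c q) \<ge> 2 ^ (J - Suc j)})
        \<le> Suc j * (real (card C) * real (card G) * (4 * real k / R))"
    using Tb Tb' unfolding n_def[symmetric] of_nat_Suc distrib_right mult_1 by linarith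
  show ?case
    by (intro exI[of _ T'] conjI) (fact T' Tb'')+
qed

text \<open>A colouring with \<open>2 * J\<close> colours is good when the first \<open>J\<close> colour classes cover a member.
  More than half of all colourings are good, so some colouring is good together with its mirror
  image under reversal of the colours.\<close>

lemma spread_disjoint_pair:
  fixes G :: "'i set" and S :: "'i \<Rightarrow> 'a set"
  assumes fin: "finite G" "G \<noteq> {}" "\<And>q. q \<in> G \<Longrightarrow> finite (S q)"
    and small: "\<And>q. q \<in> G \<Longrightarrow> card (S q) < 2 ^ J" and R: "R > 16 * (real J)\<^sup>2"
    and spread: "\<And>E. E \<noteq> {} \<Longrightarrow> finite E \<Longrightarrow>
       real (card {q\<in>G. E \<subseteq> S q}) * R ^ card E \<le> real (card G)"
  shows "\<exists>q\<in>G. \<exists>q'\<in>G. S q \<inter> S q' = {}"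
proof (cases "J = 0")
  case True
  then show ?thesis using fin small by fastforce
next
  case False
  define X where "X = (\<Union>q\<in>G. S q)"
  define k where "k = 2 * J"
  define C where "C = X \<rightarrow>\<^sub>E {..<k}"
  have finX: "finite X" and SX: "\<forall>q\<in>G. S q \<subseteq> X" using fin by (auto simp: X_def)
  have finC: "finite C" unfolding C_def using finX by (simp add: finite_PiE)
  have "C \<noteq> {}" using False by (auto simp: C_def PiE_eq_empty_iff k_def lessThan_empty_iff)
  then have C0: "card C > 0" using finC by (simp add: card_gt_0_iff)
  have G0: "card G > 0" using fin by (simp add: card_gt_0_iff)
  have R0: "R > 0" using R by (meson le_less_trans mult_nonneg_nonneg zero_le_numeral zero_le_power2)
  have "real J \<ge> 1" using False by simp
  then have "real J * 1 \<le> real J * real J" by (intro mult_left_mono) auto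
  then have kR: "4 * real k \<le> R" using R unfolding k_def power2_eq_square by simp
  have sp: "\<forall>E. E \<noteq> {} \<longrightarrow> E \<subseteq> X \<longrightarrow> real (card {q\<in>G. E \<subseteq> S q}) * R ^ card E \<le> real (card G)"
    using finX by (auto intro: spread finite_subset)
  have sm: "\<forall>q\<in>G. card (S q) < 2 ^ J" using small by blast
  have Jk: "J \<le> k" by (simp add: k_def)
  obtain T where T: "\<forall>c\<in>C. \<forall>q\<in>G. T c q \<subseteq> S q"
      "\<forall>c\<in>C. \<forall>q\<in>G. \<exists>q'\<in>G. S q' \<subseteq> T c q \<union> {x. c x < J}"
    and Tb: "real (card {(c, q) \<in> C \<times> G. card (T c q) \<ge> 2 ^ (J - J)})
        \<le> J * (real (card C) * real (card G) * (4 * real k / R))"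
    using fragment_iterate[OF fin(1) finX kR R0 SX sm sp order_refl Jk, folded C_def]
    by (elim exE conjE) (rule that)
  note TS = T(1)[rule_format] and Tcov = T(2)[rule_format]
  define Good where "Good = {c\<in>C. \<exists>q\<in>G. S q \<subseteq> {x. c x < J}}"
  have "card ((C - Good) \<times> G) \<le> card {(c, q) \<in> C \<times> G. card (T c q) \<ge> 2 ^ (J - J)}"
  proof (rule card_mono)
    show "finite {(c, q) \<in> C \<times> G. card (T c q) \<ge> 2 ^ (J - J)}"
      by (rule finite_subset[OF _ finite_cartesian_product[OF finC fin(1)]]) auto
    show "(C - Good) \<times> G \<subseteq> {(c, q) \<in> C \<times> G. card (T c q) \<ge> 2 ^ (J - J)}"
    proof (clarify, intro conjI)
      fix c q assume *: "c \<in> C" "c \<notin> Good" "q \<in> G"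
      \<comment> \<open>An empty fragment would make the colouring good, so for a bad colouring
        every \<open>q\<close> gives an exceptional pair.\<close>
      have "T c q \<noteq> {}" using Tcov[of c q] * by (auto simp: Good_def)
      moreover have "finite (T c q)" using TS[of c q] * fin(3) by (meson finite_subset)
      ultimately show "2 ^ (J - J) \<le> card (T c q)" by (simp add: Suc_le_eq card_gt_0_iff)
    qed auto
  qed
  then have "real (card (C - Good)) * real (card G) \<le> J * (real (card C) * real (card G) * (4 * real k / R))"
    using Tb by (simp add: card_cartesian_product flip: of_nat_mult)
  \<comment> \<open>\<open>J\<close> stages lose \<open>4 * real k / R\<close> each, with k = 2 * J.
    The constant 16 in the hypothesis on \<open>R\<close> makes this total less than 1/2.\<close>
  also have "\<dots> = real (card G) * real (card C) * (8 * (real J)\<^sup>2 / R)"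
    by (simp add: k_def power2_eq_square)
  also have "\<dots> < real (card G) * real (card C) * (1 / 2)"
    using R R0 C0 G0 by (intro mult_strict_left_mono) (auto simp: divide_simps)
  finally have "real (card (C - Good)) < real (card C) / 2" using G0 by simp
  moreover have "card (C - Good) = card C - card Good" "card Good \<le> card C"
    using finC by (auto simp: Good_def intro!: card_Diff_subset card_mono)
  ultimately have half: "2 * card Good > card C" by linarith
  \<comment> \<open>Because k = 2 * J, reversal exchanges the colours below \<open>J\<close> with
    the others. Members covered by the low colours of \<open>c\<close> and of \<open>rev c\<close>
    therefore cannot meet.\<close>
  define rev where "rev c = (\<lambda>x\<in>X. k - 1 - c x)" for c :: "'a \<Rightarrow> nat"
  have revC: "rev c \<in> C" if "c \<in> C" for c
    using that False by (auto simp: rev_def C_def k_def PiE_iff)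
  have revrev: "rev (rev c) = c" if c: "c \<in> C" for c
  proof
    fix x show "rev (rev c) x = c x"
      using c by (cases "x \<in> X") (auto simp: rev_def C_def PiE_iff extensional_def)
  qed
  have "inj_on rev Good" by (rule inj_on_inverseI[of _ rev]) (auto simp: Good_def revrev)
  then have "card (rev ` Good) = card Good" by (rule card_image)
  have "Good \<inter> rev ` Good \<noteq> {}"
  proof
    assume "Good \<inter> rev ` Good = {}"
    then have "card (Good \<union> rev ` Good) = 2 * card Good"
      using \<open>card (rev ` Good) = card Good\<close> finC by (subst card_Un_disjoint) (auto simp: Good_def)
    moreover have "card (Good \<union> rev ` Good) \<le> card C"
      using revC finC by (intro card_mono) (auto simp: Good_def)
    ultimately show False using half by simp
  qed
  then obtain c where c: "c \<in> Good" "rev c \<in> Good" by auto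
  then obtain q q' where q: "q \<in> G" "S q \<subseteq> {x. c x < J}" "q' \<in> G" "S q' \<subseteq> {x. rev c x < J}"
    by (auto simp: Good_def)
  have "S q \<inter> S q' = {}"
  proof (rule ccontr)
    assume "S q \<inter> S q' \<noteq> {}"
    then obtain x where x: "x \<in> S q" "x \<in> S q'" by auto
    with q SX have "c x < J" "rev c x < J" "x \<in> X" by auto
    then show False by (auto simp: rev_def k_def)
  qed
  with q show ?thesis by blast
qed

section \<open>Few moduli when all gcds are small\<close>

text \<open>A unitary divisor takes each of its primes with full multiplicity, so the cofactor has
  only new primes. Extending \<open>d\<close> by a unitary divisor of the cofactor then multiplies
  the weights, with one factor \<open>R\<close> gained for every new prime.\<close>

definition unitary_dvd :: "nat \<Rightarrow> nat \<Rightarrow> bool" where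
  "unitary_dvd d q \<longleftrightarrow> d dvd q \<and> coprime d (q div d)"

definition prime_weight :: "real \<Rightarrow> real \<Rightarrow> nat \<Rightarrow> real" where
  "prime_weight R E n = R ^ card (prime_factors n) * E ^ size (prime_factorization n)"

text \<open>The factor \<open>E ^ size (prime_factorization n)\<close> makes the sum over all exponents of a prime converge.\<close>

lemma prime_weight_1 [simp]: "prime_weight R E 1 = 1" "prime_weight R E (Suc 0) = 1"
  by (simp_all add: prime_weight_def)

lemma prime_weight_ge_1: "R \<ge> 1 \<Longrightarrow> E \<ge> 1 \<Longrightarrow> prime_weight R E n \<ge> 1"
  unfolding prime_weight_def using mult_mono[of 1 "R ^ card (prime_factors n)" 1 "E ^ size (prime_factorization n)"]
  by (simp add: one_le_power)

lemma prime_weight_mult: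
  assumes "coprime a b" "a > 0" "b > 0"
  shows "prime_weight R E (a * b) = prime_weight R E a * prime_weight R E b"
proof -
  have "prime_factors a \<inter> prime_factors b = {}"
    using assms(1) by (auto simp: in_prime_factors_iff dest: coprime_common_divisor_nat)
  then have "card (prime_factors (a * b)) = card (prime_factors a) + card (prime_factors b)"
    using assms by (simp add: prime_factors_product card_Un_disjoint)
  then show ?thesis
    using assms by (simp add: prime_weight_def prime_factorization_mult power_add)
qed

lemma prime_weight_prime_power:
  assumes "prime p" "k > 0"
  shows "prime_weight R E (p ^ k) = R * E ^ k"
  using assms by (simp add: prime_weight_def prime_factors_power prime_factorization_prime_power
      prime_prime_factors)

lemma coprime_distinct_prime_powers:
  "prime p \<Longrightarrow> prime q \<Longrightarrow> p \<noteq> q \<Longrightarrow> coprime (p ^ i) (q ^ j :: nat)"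
  by (simp add: coprime_power_left_iff coprime_power_right_iff primes_coprime)

lemma coprime_prime_power_prod:
  assumes "finite P" "\<And>q. q \<in> P \<Longrightarrow> prime q" "prime p" "p \<notin> P"
  shows "coprime (p ^ i) (\<Prod>q\<in>P. q ^ k q :: nat)"
proof (rule prod_coprime_right)
  fix q assume "q \<in> P"
  with assms show "coprime (p ^ i) (q ^ k q)"
    by (intro coprime_distinct_prime_powers) auto
qed

lemma prime_weight_prod_prime_powers:
  assumes "finite P" "\<And>p. p \<in> P \<Longrightarrow> prime p" "\<And>p. p \<in> P \<Longrightarrow> k p > 0"
  shows "prime_weight R E (\<Prod>p\<in>P. p ^ k p) = (\<Prod>p\<in>P. R * E ^ k p)"
  using assms
proof (induction P rule: finite_induct)
  case (insert p P)
  have "coprime (p ^ k p) (\<Prod>p\<in>P. p ^ k p)"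
    using insert by (intro coprime_prime_power_prod) auto
  moreover have "(\<Prod>p\<in>P. p ^ k p) > 0" "p ^ k p > 0"
    using insert by (auto intro!: prod_pos simp: prime_gt_0_nat)
  ultimately show ?case
    using insert by (simp add: prime_weight_mult prime_weight_prime_power)
qed simp

lemma unitary_dvd_1 [simp]: "unitary_dvd 1 q" "unitary_dvd (Suc 0) q"
  by (simp_all add: unitary_dvd_def)

lemma unitary_dvd_trans:
  assumes "unitary_dvd d q" "unitary_dvd e (q div d)"
  shows "coprime d e" "unitary_dvd (d * e) q"
proof -
  obtain m where m: "q = d * m" using assms by (auto simp: unitary_dvd_def)
  show "coprime d e" using assms unfolding unitary_dvd_def
    by (meson coprime_divisors dvd_refl)
  show "unitary_dvd (d * e) q"
  proof (cases "d = 0")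
    case False
    then obtain l where l: "m = e * l" using assms m by (auto simp: unitary_dvd_def)
    show ?thesis
    proof (cases "e = 0")
      case False
      then show ?thesis using assms \<open>d \<noteq> 0\<close> unfolding m l by (auto simp: unitary_dvd_def mult.assoc[symmetric])
    qed (use m l assms in \<open>auto simp: unitary_dvd_def\<close>)
  qed (use assms in \<open>auto simp: unitary_dvd_def\<close>)
qed

lemma prime_weight_unitary_dvd:
  assumes "unitary_dvd d q" "q > 0"
  shows "prime_weight R E q = prime_weight R E d * prime_weight R E (q div d)"
proof -
  have "q = d * (q div d)" using assms by (simp add: unitary_dvd_def)
  moreover have "d > 0" "q div d > 0" using assms by (auto simp: unitary_dvd_def intro: Nat.gr0I dvd_pos_nat)
  ultimately show ?thesis using prime_weight_mult[of d "q div d" R E] assms by (simp add: unitary_dvd_def)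
qed

lemma prime_weight_unitary_dvd_le:
  assumes "unitary_dvd d q" "q > 0" "R \<ge> 1" "E \<ge> 1"
  shows "prime_weight R E d \<le> prime_weight R E q"
  using prime_weight_unitary_dvd[OF assms(1,2)] prime_weight_ge_1[OF assms(3,4)]
  by (metis mult.right_neutral mult_left_mono order.trans zero_le_one)

text \<open>With full multiplicities removed, no prime of \<open>P\<close> is left in the cofactor.
  Primes of \<open>P\<close> that do not divide \<open>m\<close> contribute the factor 1.\<close>

lemma unitary_dvd_prod_prime_powers:
  assumes "finite P" "\<And>p. p \<in> P \<Longrightarrow> prime p" "m > 0"
  shows "unitary_dvd (\<Prod>p\<in>P. p ^ multiplicity p m) (m::nat)"
proof -
  let ?e = "\<Prod>p\<in>P. p ^ multiplicity p m"
  have e: "?e dvd m"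
    using assms(1,2)
  proof (induction P rule: finite_induct)
    case (insert p P)
    then have "coprime (p ^ multiplicity p m) (\<Prod>p\<in>P. p ^ multiplicity p m)"
      by (intro coprime_prime_power_prod) auto
    then show ?case using insert by (simp add: divides_mult multiplicity_dvd)
  qed simp
  obtain l where l: "m = ?e * l" using e by blast
  have "\<not> p dvd l" if "p \<in> P" for p
  proof
    assume "p dvd l"
    moreover have "p ^ multiplicity p m dvd ?e" using assms that by (intro dvd_prodI) auto
    ultimately have "p ^ multiplicity p m * p dvd m" using l by (metis mult_dvd_mono)
    then have "p ^ Suc (multiplicity p m) dvd m" by (simp add: mult.commute)
    moreover have "m \<noteq> 0" "\<not> is_unit p" using assms prime_gt_1_nat[of p] that by auto
    ultimately have "Suc (multiplicity p m) \<le> multiplicity p m" by (intro multiplicity_geI)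
    then show False by simp
  qed
  then have "coprime ?e l"
    using assms by (intro prod_coprime_left) (auto intro!: prime_imp_coprime simp: coprime_power_left_iff)
  moreover have "m div ?e = l" using l assms by (metis nonzero_mult_div_cancel_left mult_is_0 not_gr_zero)
  ultimately show ?thesis using e by (simp add: unitary_dvd_def)
qed

lemma card_le_of_fibres:
  assumes "finite Y" "f ` Y \<subseteq> {..<e::nat}" "\<And>r. real (card {y\<in>Y. f y = r}) \<le> M"
  shows "real (card Y) \<le> real e * M"
proof -
  have "card Y = (\<Sum>r<e. card {y\<in>Y. f y = r})"
    unfolding card_eq_sum by (rule sum.group[symmetric]) (use assms in auto)
  then have "real (card Y) = (\<Sum>r<e. real (card {y\<in>Y. f y = r}))" by simp
  also have "\<dots> \<le> (\<Sum>r<e. M)" by (intro sum_mono assms(3))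
  finally show ?thesis by simp
qed

lemma geometric_sum_inverse_le:
  fixes E :: real
  assumes "E > 1"
  shows "(\<Sum>v=1..n. 1 / E ^ v) \<le> 1 / (E - 1)"
proof -
  have "(\<Sum>v=1..n. 1 / E ^ v) * (E - 1) = 1 - 1 / E ^ n"
  proof (induction n)
    case (Suc n)
    have "1 / E ^ Suc n * (E - 1) = 1 / E ^ n - 1 / E ^ Suc n"
      using assms by (simp add: field_simps)
    with Suc show ?case by (simp add: distrib_right)
  qed simp
  then have "(\<Sum>v=1..n. 1 / E ^ v) = (1 - 1 / E ^ n) / (E - 1)"
    using assms by (simp add: eq_divide_eq)
  also have "\<dots> \<le> 1 / (E - 1)" using assms by (intro divide_right_mono) auto
  finally show ?thesis .
qed

text \<open>A pair \<open>(d, r)\<close> stands for the members of \<open>Q\<close> that are unitary multiples of \<open>d\<close> and whose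
  classes agree with that of \<open>r\<close> modulo \<open>d\<close>. For a pair maximising cardinality times weight, the
  prime sets of the cofactors \<open>q div d\<close> are spread, so two cofactors are coprime, and the two
  classes meet.\<close>

lemma card_le_max_gcd_times_weight:
  fixes a :: "nat \<Rightarrow> int" and Q :: "nat set"
  assumes fin: "finite Q" and pos: "\<And>q. q \<in> Q \<Longrightarrow> q > 0"
    and disj: "\<And>q q'. q \<in> Q \<Longrightarrow> q' \<in> Q \<Longrightarrow> q \<noteq> q' \<Longrightarrow> \<not> [a q = a q'] (mod int (gcd q q'))"
    and gcdD: "\<And>q q'. q \<in> Q \<Longrightarrow> q' \<in> Q \<Longrightarrow> q \<noteq> q' \<Longrightarrow> real (gcd q q') \<le> D"
    and om: "\<And>q. q \<in> Q \<Longrightarrow> card (prime_factors q) < 2 ^ J"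
    and E: "E > 1" and R0: "R0 > 16 * (real J)\<^sup>2" and R: "R \<ge> 1" "R * (E - 1) \<ge> R0"
    and V: "\<And>q. q \<in> Q \<Longrightarrow> prime_weight R E q \<le> V" "V \<ge> 1" and D: "D \<ge> 1"
  shows "real (card Q) \<le> D * V"
proof (rule ccontr)
  let ?h = "prime_weight R E"
  assume "\<not> real (card Q) \<le> D * V"
  then have big: "real (card Q) > D * V" by simp
  have R0p: "R0 > 0" using R0 by (meson le_less_trans mult_nonneg_nonneg zero_le_numeral zero_le_power2)
  define F where "F d r = {q\<in>Q. unitary_dvd d q \<and> [a q = a r] (mod int d)}" for d r
  have finF: "finite (F d r)" for d r using fin by (simp add: F_def)
  \<comment> \<open>Two members are required so that \<open>d\<close> divides the gcd of distinct
    moduli, which gives d \<le> D.\<close>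
  define Prs where "Prs = {(d, r). r \<in> Q \<and> unitary_dvd d r \<and> card (F d r) \<ge> 2}"
  have "finite Prs"
    by (rule finite_subset[of _ "{..Max Q} \<times> Q"])
       (use fin pos in \<open>auto simp: Prs_def unitary_dvd_def dest!: dvd_imp_le intro: order_trans[OF _ Max_ge]\<close>)
  have "D * V \<ge> 1 * 1" using D V by (intro mult_mono) auto
  then have "card Q \<ge> 2" using big by simp
  then obtain q0 where q0: "q0 \<in> Q" by fastforce
  have F1: "F 1 q0 = Q" by (auto simp: F_def)
  have P1: "(1, q0) \<in> Prs" using F1 q0 \<open>card Q \<ge> 2\<close> by (simp add: Prs_def)
  \<comment> \<open>The factor \<open>real d\<close> pays for the refinement into residue classes:
    extending \<open>d\<close> by \<open>e\<close> splits a class modulo \<open>d\<close> into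
    \<open>e\<close> classes. At d = 1 the value is \<open>card Q\<close>, which exceeds D * V by
    assumption.\<close>
  define val where "val = (\<lambda>(d, r). real (card (F d r)) * real d * ?h d)"
  obtain d r where dr: "(d, r) \<in> Prs" and mx: "\<And>d' r'. (d', r') \<in> Prs \<Longrightarrow> val (d', r') \<le> val (d, r)"
  proof -
    have "Max (val ` Prs) \<in> val ` Prs" using \<open>finite Prs\<close> P1 by (intro Max_in) auto
    then obtain d r where dr: "(d, r) \<in> Prs" "Max (val ` Prs) = val (d, r)" by auto
    show thesis
    proof (rule that[OF dr(1)])
      fix d' r' assume "(d', r') \<in> Prs"
      then show "val (d', r') \<le> val (d, r)" unfolding dr(2)[symmetric] using \<open>finite Prs\<close> by simp
    qed
  qed
  define G where "G = F d r"
  have finG: "finite G" and cG: "card G \<ge> 2" and rQ: "r \<in> Q" and ud: "unitary_dvd d r"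
    using dr finF by (auto simp: G_def Prs_def)
  have GQ: "q \<in> Q" "unitary_dvd d q" "[a q = a r] (mod int d)" if "q \<in> G" for q
    using that by (auto simp: G_def F_def)
  have d0: "d > 0" using ud pos[OF rQ] by (auto simp: unitary_dvd_def intro: Nat.gr0I)
  have Vbig: "real (card G) * real d * ?h d > D * V"
    using mx[OF P1] big by (simp add: val_def F1[simplified] G_def)
  have h1: "?h n \<ge> 1" for n using R E by (intro prime_weight_ge_1) auto
  have Gd: "gcd q q' \<noteq> d" if "q \<in> G" "q' \<in> G" "q \<noteq> q'" for q q'
  proof
    assume "gcd q q' = d"
    moreover have "[a q = a q'] (mod int d)" using GQ that by (meson cong_sym cong_trans)
    ultimately show False using disj[of q q'] GQ that by auto
  qed
  obtain q1 q2 where q12: "q1 \<in> G" "q2 \<in> G" "q1 \<noteq> q2"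
    using cG by (metis card_le_Suc0_iff_eq finG not_less_eq_eq numeral_2_eq_2)
  have common_le: "real m \<le> D" if "m dvd q" "m dvd q'" "q \<in> G" "q' \<in> G" "q \<noteq> q'" for m q q'
  proof -
    have "m dvd gcd q q'" using that by simp
    then have "m \<le> gcd q q'" using pos GQ that by (intro dvd_imp_le) auto
    then show ?thesis using gcdD[of q q'] GQ that by (meson of_nat_le_iff order.trans)
  qed
  have dD: "real d \<le> D" using common_le[OF _ _ q12] GQ q12 by (auto simp: unitary_dvd_def)
  \<comment> \<open>By pigeonhole over the classes modulo d * e, a class with two members is again
    an admissible pair and is bounded by maximality. A class with at most one member is harmless
    because the maximal value exceeds D * V, while d * e \<le> D and the weight of d * e is at most
    V. When \<open>Y\<close> is a singleton, d * e may exceed D, so that case compares only the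
    weights and uses d \<le> D.\<close>
  have e_bound: "real (card Y) \<le> real (card G) / ?h e"
    if Y: "Y \<subseteq> G" "\<And>q. q \<in> Y \<Longrightarrow> unitary_dvd e (q div d)" for Y e
  proof -
    have finY: "finite Y" using Y finG finite_subset by blast
    consider "card Y = 0" | "card Y = 1" | "card Y \<ge> 2" by linarith
    then show ?thesis
    proof cases
      case 1
      then show ?thesis using h1[of e] by (simp add: divide_nonneg_pos)
    next
      case 2
      then obtain q where q: "q \<in> Y" by (metis card_1_singletonE insertI1)
      have qG: "q \<in> G" using q Y by auto
      have u: "unitary_dvd (d * e) q" "coprime d e"
        using unitary_dvd_trans[of d q e] GQ[OF qG] Y(2)[OF q] by auto
      have q0: "q > 0" using pos GQ[OF qG] by blast
      have e0: "e > 0" using u(1) q0 by (auto simp: unitary_dvd_def intro: Nat.gr0I)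
      have "?h d * ?h e = ?h (d * e)" using prime_weight_mult u d0 e0 by simp
      also have "\<dots> \<le> ?h q" using prime_weight_unitary_dvd_le[OF u(1) q0] R E by simp
      also have "\<dots> \<le> V" using V GQ[OF qG] by blast
      finally have "?h d * ?h e \<le> V" .
      then have "real d * (?h d * ?h e) \<le> D * V" using dD D h1[of d] h1[of e] by (intro mult_mono) auto
      also have "\<dots> < real d * ?h d * real (card G)" using Vbig by (simp add: mult_ac)
      finally have "(real d * ?h d) * ?h e < (real d * ?h d) * real (card G)" by (simp add: mult.assoc)
      then have "?h e < real (card G)" using d0 h1[of d] by (simp add: mult_less_cancel_left_pos)
      then show ?thesis using 2 h1[of e] by (simp add: divide_simps)
    next
      case 3
      then obtain q q' where q: "q \<in> Y" "q' \<in> Y" "q \<noteq> q'"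
        by (metis card_le_Suc0_iff_eq finY not_less_eq_eq numeral_2_eq_2)
      have qG: "q \<in> G" "q' \<in> G" using q Y by auto
      have ue: "unitary_dvd (d * e) q" "coprime d e" if "q \<in> Y" for q
        using unitary_dvd_trans[of d q e] GQ[of q] Y that by auto
      have q0: "q > 0" using pos GQ[OF qG(1)] by blast
      have e0: "e > 0" using ue(1)[OF q(1)] q0 by (auto simp: unitary_dvd_def intro: Nat.gr0I)
      have de: "real (d * e) \<le> D"
        by (rule common_le[OF _ _ qG q(3)]) (use ue(1) q in \<open>auto simp: unitary_dvd_def\<close>)
      have hm: "?h d * ?h e = ?h (d * e)" using prime_weight_mult ue(2)[OF q(1)] d0 e0 by simp
      define M where "M = real (card G) / (real e * ?h e)"
      \<comment> \<open>All classes of \<open>G\<close> agree modulo \<open>d\<close>, so the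
        difference from \<open>a r\<close> divided by \<open>d\<close>, taken modulo
        \<open>e\<close>, determines the class modulo d * e.\<close>
      define f where "f q = nat (((a q - a r) div int d) mod int e)" for q
      have "real (card Y) \<le> real e * M"
      proof (rule card_le_of_fibres[OF finY])
        show "f ` Y \<subseteq> {..<e}" using e0 by (auto simp: f_def nat_less_iff)
        fix t
        let ?Z = "{y\<in>Y. f y = t}"
        show "real (card ?Z) \<le> M"
        proof (cases "card ?Z \<ge> 2")
          case False
          have "?h d * ?h e \<le> ?h q" unfolding hm
            using prime_weight_unitary_dvd_le[OF ue(1)[OF q(1)] q0] R E by simp
          also have "\<dots> \<le> V" using V GQ[OF qG(1)] by blast
          finally have "real (d * e) * (?h d * ?h e) \<le> D * V"
            using de D h1[of d] h1[of e] by (intro mult_mono) auto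
          also have "\<dots> < real d * ?h d * real (card G)" using Vbig by (simp add: mult_ac)
          finally have "(real d * ?h d) * (real e * ?h e) < (real d * ?h d) * real (card G)"
            by (simp add: mult_ac)
          then have "real e * ?h e < real (card G)" using d0 h1[of d] by (simp add: mult_less_cancel_left_pos)
          then have "1 \<le> M" using e0 h1[of e] by (simp add: M_def divide_simps)
          then show ?thesis using False by linarith
        next
          case True
          then have "?Z \<noteq> {}" by (metis card.empty not_numeral_le_zero)
          then obtain z where z: "z \<in> ?Z" by blast
          have zG: "z \<in> G" using z Y by auto
          have "?Z \<subseteq> F (d * e) z"
          proof
            fix y assume y: "y \<in> ?Z"
            then have yG: "y \<in> G" using Y by auto
            obtain k l where k: "a y - a r = int d * k" and l: "a z - a r = int d * l"
              using GQ(3)[OF yG] GQ(3)[OF zG] by (auto simp: cong_iff_dvd_diff elim!: dvdE)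
            have "k mod int e = l mod int e"
              using y z d0 e0 by (auto simp: f_def k l eq_nat_nat_iff)
            then have "int e dvd k - l" by (simp add: mod_eq_dvd_iff)
            then have "int d * int e dvd int d * (k - l)" by simp
            also have "int d * (k - l) = a y - a z" using k l by (simp add: right_diff_distrib)
            finally have "[a y = a z] (mod int (d * e))" by (simp add: cong_iff_dvd_diff)
            then show "y \<in> F (d * e) z" using ue(1)[of y] y GQ(1)[OF yG] by (simp add: F_def)
          qed
          then have cz: "card ?Z \<le> card (F (d * e) z)" by (intro card_mono finF)
          then have "(d * e, z) \<in> Prs" using True GQ(1)[OF zG] ue(1)[of z] z by (simp add: Prs_def)
          from mx[OF this] have "real (card (F (d * e) z)) * (real e * ?h e) * (real d * ?h d)
              \<le> real (card G) * (real d * ?h d)"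
            by (simp add: val_def G_def mult_ac flip: hm)
          then have "real (card (F (d * e) z)) * (real e * ?h e) \<le> real (card G)"
            using d0 h1[of d] by (simp add: mult_le_cancel_right_pos)
          then have "real (card (F (d * e) z)) \<le> M"
            using e0 h1[of e] by (simp add: M_def pos_le_divide_eq)
          then show ?thesis using cz by linarith
        qed
      qed
      then show ?thesis using e0 by (simp add: M_def)
    qed
  qed
  define S where "S q = prime_factors (q div d)" for q
  have qd: "q div d > 0" if "q \<in> G" for q
    using GQ[OF that] pos d0 by (auto simp: unitary_dvd_def div_greater_zero_iff intro!: dvd_imp_le)
  have spread: "real (card {q\<in>G. P \<subseteq> S q}) * R0 ^ card P \<le> real (card G)"
    if P: "P \<noteq> {}" "finite P" for P
  proof (cases "{q\<in>G. P \<subseteq> S q} = {}")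
    case False
    define Z where "Z = {q\<in>G. P \<subseteq> S q}"
    have prP: "prime p" if "p \<in> P" for p using False that by (auto simp: S_def in_prime_factors_iff)
    define N where "N = Max Q"
    \<comment> \<open>Knowing that the primes of \<open>P\<close> divide a cofactor does not fix a
      unitary divisor. Sorting by exact exponents does, and \<open>e_bound\<close> applies to each
      exponent vector.\<close>
    define vec where "vec q = (\<lambda>p\<in>P. multiplicity p (q div d))" for q
    have finZ: "finite Z" using finG by (simp add: Z_def)
    have vec: "vec ` Z \<subseteq> P \<rightarrow>\<^sub>E {1..N}"
    proof (rule image_subsetI, rule PiE_I)
      fix q p assume q: "q \<in> Z" and p: "p \<in> P"
      then have qG: "q \<in> G" and "p \<in> prime_factors (q div d)" by (auto simp: Z_def S_def)
      then have "multiplicity p (q div d) \<ge> 1"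
        using prP[OF p] qd[OF qG] by (simp add: in_prime_factors_iff Suc_le_eq prime_multiplicity_gt_zero_iff)
      moreover have "multiplicity p (q div d) \<le> N"
      proof -
        have "multiplicity p (q div d) < p ^ multiplicity p (q div d)"
          using prime_gt_1_nat[OF prP[OF p]] by (intro power_gt_expt) simp
        also have "\<dots> \<le> q div d" by (rule dvd_imp_le[OF multiplicity_dvd qd[OF qG]])
        also have "\<dots> \<le> q" by simp
        also have "q \<le> N" unfolding N_def using fin GQ(1)[OF qG] by (rule Max_ge)
        finally show ?thesis by simp
      qed
      ultimately show "vec q p \<in> {1..N}" using p by (simp add: vec_def)
    qed (simp add: vec_def)
    have "card Z = (\<Sum>v\<in>P \<rightarrow>\<^sub>E {1..N}. card {q\<in>Z. vec q = v})"
      unfolding card_eq_sum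
      by (rule sum.group[symmetric]) (use finZ P vec in \<open>auto simp: finite_PiE\<close>)
    then have "real (card Z) = (\<Sum>v\<in>P \<rightarrow>\<^sub>E {1..N}. real (card {q\<in>Z. vec q = v}))" by simp
    also have "\<dots> \<le> (\<Sum>v\<in>P \<rightarrow>\<^sub>E {1..N}. real (card G) * (\<Prod>p\<in>P. 1 / (R * E ^ v p)))"
    proof (rule sum_mono)
      fix v assume v: "v \<in> P \<rightarrow>\<^sub>E {1..N}"
      define e where "e = (\<Prod>p\<in>P. p ^ v p)"
      have "real (card {q\<in>Z. vec q = v}) \<le> real (card G) / ?h e"
      proof (rule e_bound)
        fix q assume q: "q \<in> {q\<in>Z. vec q = v}"
        then have "e = (\<Prod>p\<in>P. p ^ multiplicity p (q div d))"
          unfolding e_def by (auto simp: vec_def)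
        then show "unitary_dvd e (q div d)"
          using unitary_dvd_prod_prime_powers[OF P(2) prP qd] q by (auto simp: Z_def)
      qed (auto simp: Z_def)
      also have "?h e = (\<Prod>p\<in>P. R * E ^ v p)"
        unfolding e_def by (rule prime_weight_prod_prime_powers[OF P(2) prP]) (use v in force)+
      finally show "real (card {q\<in>Z. vec q = v}) \<le> real (card G) * (\<Prod>p\<in>P. 1 / (R * E ^ v p))"
        by (simp add: prod_dividef)
    qed
    \<comment> \<open>The sum over exponent vectors factorises into one geometric series per prime,
      each at most 1 / (R * (E - 1)) \<le> 1 / R0.\<close>
    also have "\<dots> = real (card G) * (\<Prod>p\<in>P. \<Sum>k=1..N. 1 / (R * E ^ k))"
      by (subst prod_sum_PiE[OF P(2)]) (auto simp only: sum_distrib_left finite_atLeastAtMost)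
    also have "\<dots> \<le> real (card G) * (\<Prod>p\<in>P. 1 / R0)"
    proof (intro mult_left_mono prod_mono conjI)
      fix p assume "p \<in> P"
      have "(\<Sum>k=1..N. 1 / (R * E ^ k)) = (\<Sum>k=1..N. 1 / E ^ k) / R"
        by (simp add: sum_divide_distrib mult.commute)
      also have "\<dots> \<le> (1 / (E - 1)) / R"
        using R E geometric_sum_inverse_le[OF E, of N] by (intro divide_right_mono) auto
      also have "\<dots> \<le> 1 / R0" using R R0p E by (simp add: divide_simps mult.commute)
      finally show "(\<Sum>k=1..N. 1 / (R * E ^ k)) \<le> 1 / R0" .
      show "0 \<le> (\<Sum>k=1..N. 1 / (R * E ^ k))" using R E by (intro sum_nonneg) auto
    qed auto
    also have "\<dots> = real (card G) / R0 ^ card P" by (simp add: power_divide)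
    finally show ?thesis using R0p unfolding Z_def by (simp add: pos_le_divide_eq)
  qed (simp only: card.empty of_nat_0 mult_zero_left of_nat_0_le_iff)
  have "\<exists>q\<in>G. \<exists>q'\<in>G. S q \<inter> S q' = {}"
  proof (rule spread_disjoint_pair[OF finG _ _ _ R0 spread])
    show "G \<noteq> {}" using q12 by auto
    fix q assume q: "q \<in> G"
    show "finite (S q)" by (simp add: S_def)
    have "q div d dvd q" using GQ(2)[OF q] by (auto simp: unitary_dvd_def div_dvd_iff_mult)
    then have "S q \<subseteq> prime_factors q" unfolding S_def using pos GQ(1)[OF q] by (intro dvd_prime_factors) auto
    then have "card (S q) \<le> card (prime_factors q)" by (intro card_mono) auto
    then show "card (S q) < 2 ^ J" using om[OF GQ(1)[OF q]] by simp
  qed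
  then obtain q q' where q: "q \<in> G" "q' \<in> G" "S q \<inter> S q' = {}" by blast
  have gcd_d: "gcd x y = d" if "x \<in> G" "y \<in> G" "coprime (x div d) (y div d)" for x y
  proof -
    have "x = d * (x div d)" "y = d * (y div d)" using GQ(2)[OF that(1)] GQ(2)[OF that(2)] by (auto simp: unitary_dvd_def)
    then show ?thesis using that(3) by (metis coprime_iff_gcd_eq_1 gcd_mult_distrib_nat mult.right_neutral)
  qed
  show False
  proof (cases "q = q'")
    case False
    have "coprime (q div d) (q' div d)"
    proof (rule ccontr)
      assume "\<not> coprime (q div d) (q' div d)"
      then obtain p where "prime p" "p dvd q div d" "p dvd q' div d"
        by (metis coprime_iff_gcd_eq_1 gcd_greatest_iff prime_factor_nat)
      then have "p \<in> S q \<inter> S q'" using qd q by (auto simp: S_def in_prime_factors_iff)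
      then show False using q by simp
    qed
    then show False using gcd_d Gd q False by blast
  next
    \<comment> \<open>The spread lemma may return the same member twice, but only if its prime set
      is empty. Then the modulus equals \<open>d\<close>, and its gcd with any other member of
      \<open>G\<close> is again \<open>d\<close>.\<close>
    case True
    then have "prime_factors (q div d) = {}" using q by (simp add: S_def)
    then have "q div d = 1" using qd[OF q(1)] prime_factorization_empty_iff[of "q div d"] by auto
    moreover obtain y where "y \<in> G" "y \<noteq> q" using q12 by metis
    ultimately show False using gcd_d[of q y] Gd[of q y] q by simp
  qed
qed

section \<open>Integers with many prime factors\<close>

lemma harmonic_sum_le_ln:
  assumes "n \<ge> 1"
  shows "(\<Sum>d=1..n. 1 / real d) \<le> 1 + ln (real n)"
  using assms
proof (induction n rule: dec_induct)
  case (step n)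
  have "ln (real n / real (Suc n)) \<le> real n / real (Suc n) - 1"
    using step by (intro ln_le_minus_one) auto
  also have "\<dots> = - (1 / real (Suc n))" by (simp add: field_simps)
  finally have "1 / real (Suc n) \<le> ln (real (Suc n)) - ln (real n)"
    using step by (simp add: ln_div)
  then show ?case using step by simp
qed simp

lemma card_multiples_le:
  fixes d N :: nat
  assumes "d > 0"
  shows "real (card {n\<in>{1..N}. d dvd n}) \<le> real N / real d"
proof -
  have "{n\<in>{1..N}. d dvd n} \<subseteq> (\<lambda>k. d * k) ` {1..N div d}"
  proof
    fix n assume n: "n \<in> {n\<in>{1..N}. d dvd n}"
    then obtain k where "n = d * k" by auto
    with n assms show "n \<in> (\<lambda>k. d * k) ` {1..N div d}"
      by (intro image_eqI[of _ _ k]) (auto simp: less_eq_div_iff_mult_less_eq mult.commute intro: Nat.gr0I Suc_leI)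
  qed
  then have "card {n\<in>{1..N}. d dvd n} \<le> card {1..N div d}"
    by (intro surj_card_le) auto
  also have "\<dots> = N div d" by simp
  finally show ?thesis using of_nat_div_le_of_nat[of N d, where ?'a = real] by linarith
qed

text \<open>Distribute the prime factors of \<open>n\<close> over \<open>m\<close> slots, the extra
  value \<open>m\<close> meaning that a prime is dropped, and multiply within each slot. The slot of
  a prime is recovered as the one entry it divides, so different assignments give different
  tuples.\<close>

lemma card_assignments_le_card_divisor_tuples:
  fixes n N m :: nat
  assumes n: "n \<in> {1..N}"
  shows "(m + 1) ^ card (prime_factors n) \<le> card {d \<in> {..<m} \<rightarrow>\<^sub>E {1..N}. (\<Prod>i<m. d i) dvd n}"
proof -
  let ?P = "prime_factors n"
  define \<Phi> where "\<Phi> g = (\<lambda>i\<in>{..<m}. \<Prod>{p\<in>?P. g p = i})" for g :: "nat \<Rightarrow> nat"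
  have rad: "\<Prod>A dvd n" if "A \<subseteq> ?P" for A
  proof -
    have "\<Prod>A dvd \<Prod>?P" using that by (intro prod_dvd_prod_subset) auto
    also have "\<dots> dvd (\<Prod>p\<in>?P. p ^ multiplicity p n)"
    proof (rule prod_dvd_prod)
      fix p assume "p \<in> ?P"
      then have "multiplicity p n > 0" by (metis count_greater_zero_iff count_prime_factorization_nonprime count_prime_factorization_prime in_prime_factors_iff)
      then show "p dvd p ^ multiplicity p n" by (metis dvd_power)
    qed
    also have "\<dots> = n" using n by (intro prime_factorization_nat[symmetric]) auto
    finally show ?thesis .
  qed
  have "inj_on \<Phi> (?P \<rightarrow>\<^sub>E {..m})"
  proof (rule inj_onI)
    fix g h assume g: "g \<in> ?P \<rightarrow>\<^sub>E {..m}" and h: "h \<in> ?P \<rightarrow>\<^sub>E {..m}" and eq: "\<Phi> g = \<Phi> h"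
    have key: "p dvd \<Phi> f i \<longleftrightarrow> f p = i" if "p \<in> ?P" "i < m" for f p i
    proof
      assume "p dvd \<Phi> f i"
      then have "p dvd \<Prod>{p\<in>?P. f p = i}" using that by (simp add: \<Phi>_def)
      moreover have "prime p" using that by (simp add: in_prime_factors_iff)
      ultimately have "\<exists>q\<in>{p\<in>?P. f p = i}. p dvd q"
        by (subst (asm) prime_dvd_prod_iff) auto
      then obtain q where "q \<in> ?P" "f q = i" "p dvd q" by blast
      then show "f p = i" using that by (metis in_prime_factors_iff primes_dvd_imp_eq)
    next
      assume "f p = i"
      then show "p dvd \<Phi> f i" using that by (auto simp: \<Phi>_def intro!: dvd_prodI[of _ p "\<lambda>x. x", simplified])
    qed
    show "g = h"
    proof (rule PiE_ext[OF g h])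
      fix p assume p: "p \<in> ?P"
      then have le: "g p \<le> m" "h p \<le> m" using g h by auto
      show "g p = h p"
        using key[OF p, of "g p" g] key[OF p, of "h p" g] key[OF p, of "h p" h] key[OF p, of "g p" h] le eq
        by (metis le_neq_implies_less)
    qed
  qed
  moreover have "\<Phi> ` (?P \<rightarrow>\<^sub>E {..m}) \<subseteq> {d \<in> {..<m} \<rightarrow>\<^sub>E {1..N}. (\<Prod>i<m. d i) dvd n}"
  proof (rule image_subsetI, rule CollectI, rule conjI)
    fix g assume "g \<in> ?P \<rightarrow>\<^sub>E {..m}"
    show "\<Phi> g \<in> {..<m} \<rightarrow>\<^sub>E {1..N}"
    proof (rule PiE_I)
      fix i assume "i \<in> {..<m}"
      then have "\<Phi> g i dvd n" using rad[of "{p\<in>?P. g p = i}"] by (simp add: \<Phi>_def)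
      then show "\<Phi> g i \<in> {1..N}" using n by (auto dest: dvd_imp_le intro: Nat.gr0I Suc_leI)
    qed (simp add: \<Phi>_def)
    have "(\<Prod>i<m. \<Phi> g i) = (\<Prod>i\<in>{..<m}. \<Prod>p\<in>{p \<in> {p\<in>?P. g p < m}. g p = i}. p)"
      by (intro prod.cong refl) (auto simp: \<Phi>_def intro!: prod.cong)
    also have "\<dots> = \<Prod>{p\<in>?P. g p < m}" by (rule prod.group) auto
    also have "\<dots> dvd n" by (rule rad) auto
    finally show "(\<Prod>i<m. \<Phi> g i) dvd n" .
  qed
  ultimately have "card (?P \<rightarrow>\<^sub>E {..m}) \<le> card {d \<in> {..<m} \<rightarrow>\<^sub>E {1..N}. (\<Prod>i<m. d i) dvd n}"
    by (intro card_inj_on_le) (auto simp: finite_PiE)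
  then show ?thesis by (simp add: card_PiE)
qed

text \<open>No estimate for \<open>\<Sum>1/p\<close> is needed: \<open>(m + 1) ^ \<omega>(n)\<close> is at most the number of ways to write \<open>n\<close> as an
  ordered product of \<open>m + 1\<close> factors.\<close>

lemma card_many_prime_factors_le:
  fixes N m k :: nat
  assumes N: "N \<ge> 1"
  shows "real (card {n\<in>{1..N}. k \<le> card (prime_factors n)}) * (m + 1) ^ k \<le> N * (1 + ln N) ^ m"
proof -
  define Om where "Om = {n\<in>{1..N}. k \<le> card (prime_factors n)}"
  let ?D = "{..<m} \<rightarrow>\<^sub>E {1..N}"
  have "real (card Om) * (m + 1) ^ k = (\<Sum>n\<in>Om. real ((m + 1) ^ k))" by simp
  also have "\<dots> \<le> (\<Sum>n\<in>Om. real (card {d\<in>?D. (\<Prod>i<m. d i) dvd n}))"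
  proof (rule sum_mono)
    fix n assume n: "n \<in> Om"
    have "(m + 1) ^ k \<le> (m + 1) ^ card (prime_factors n)" using n by (intro power_increasing) (auto simp: Om_def)
    also have "\<dots> \<le> card {d\<in>?D. (\<Prod>i<m. d i) dvd n}"
      using n by (intro card_assignments_le_card_divisor_tuples) (auto simp: Om_def)
    finally show "real ((m + 1) ^ k) \<le> real (card {d\<in>?D. (\<Prod>i<m. d i) dvd n})" by (simp only: of_nat_le_iff)
  qed
  also have "\<dots> \<le> (\<Sum>n\<in>{1..N}. real (card {d\<in>?D. (\<Prod>i<m. d i) dvd n}))"
    by (rule sum_mono2) (auto simp: Om_def)
  also have "\<dots> = (\<Sum>n\<in>{1..N}. \<Sum>d\<in>?D. if (\<Prod>i<m. d i) dvd n then 1 else 0)"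
    by (intro sum.cong refl) (simp add: sum.If_cases finite_PiE Int_def)
  also have "\<dots> = (\<Sum>d\<in>?D. \<Sum>n\<in>{1..N}. if (\<Prod>i<m. d i) dvd n then 1 else 0)"
    by (rule sum.swap)
  also have "\<dots> = (\<Sum>d\<in>?D. real (card {n\<in>{1..N}. (\<Prod>i<m. d i) dvd n}))"
    by (intro sum.cong refl) (simp add: sum.If_cases Int_def)
  also have "\<dots> \<le> (\<Sum>d\<in>?D. N * (\<Prod>i<m. 1 / real (d i)))"
  proof (rule sum_mono)
    fix d assume d: "d \<in> ?D"
    have "(\<Prod>i<m. d i) > 0" using d by (intro prod_pos) (auto simp: PiE_iff Suc_le_eq)
    from card_multiples_le[OF this, of N]
    show "real (card {n\<in>{1..N}. (\<Prod>i<m. d i) dvd n}) \<le> N * (\<Prod>i<m. 1 / real (d i))"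
      by (simp add: prod_dividef)
  qed
  also have "\<dots> = N * (\<Prod>i<m. \<Sum>d=1..N. 1 / real d)"
    \<comment> \<open>The entries of a tuple range independently over \<open>{1..N}\<close>, so the
      sum is a product of \<open>m\<close> harmonic sums.\<close>
    by (subst prod_sum_PiE) (auto simp only: sum_distrib_left finite_atLeastAtMost finite_lessThan)
  also have "\<dots> \<le> N * (1 + ln N) ^ m"
    using harmonic_sum_le_ln[OF N] by (auto intro!: mult_left_mono power_mono sum_nonneg)
  finally show ?thesis unfolding Om_def by simp
qed

lemma sum_inverse_squares_le:
  fixes A N :: nat
  assumes "A \<ge> 1"
  shows "(\<Sum>a\<in>{A<..N}. 1 / (real a)\<^sup>2) \<le> 1 / A"
proof (cases "A \<le> N")
  case True
  then have "(\<Sum>a\<in>{A<..N}. 1 / (real a)\<^sup>2) \<le> 1 / A - 1 / N"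
  proof (induction N rule: dec_induct)
    case (step n)
    have n: "real n > 0" using step assms by auto
    have "1 / (real (Suc n))\<^sup>2 \<le> 1 / (real n * real (Suc n))"
      using n unfolding power2_eq_square by (intro divide_left_mono mult_right_mono) auto
    also have "\<dots> = 1 / n - 1 / Suc n" using n by (simp add: field_simps)
    finally have "1 / (real (Suc n))\<^sup>2 \<le> 1 / n - 1 / Suc n" .
    moreover have "{A<..Suc n} = insert (Suc n) {A<..n}" using step by auto
    ultimately show ?case using step by simp
  qed simp
  then show ?thesis by (smt (verit) divide_nonneg_nonneg of_nat_0_le_iff)
qed auto

text \<open>Take \<open>a\<close> with half of each exponent, rounded down. An exponent is at most 1
  plus twice its half, so a total excess above 2 * B forces the halves to sum to more than B, and
  each prime is at least 2.\<close>

lemma exists_large_square_divisor: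
  fixes n :: nat
  assumes n: "n > 0" and big: "size (prime_factorization n) > card (prime_factors n) + 2 * B"
  shows "\<exists>a>2 ^ B. a\<^sup>2 dvd n"
proof -
  let ?P = "prime_factors n"
  define a where "a = (\<Prod>p\<in>?P. p ^ (multiplicity p n div 2))"
  have "a\<^sup>2 = (\<Prod>p\<in>?P. p ^ (2 * (multiplicity p n div 2)))"
    by (simp add: a_def prod_power_distrib power_mult[symmetric] mult.commute)
  also have "\<dots> dvd (\<Prod>p\<in>?P. p ^ multiplicity p n)"
    by (intro prod_dvd_prod le_imp_power_dvd) auto
  also have "\<dots> = n" using n by (intro prime_factorization_nat[symmetric])
  finally have "a\<^sup>2 dvd n" .
  have "size (prime_factorization n) = (\<Sum>p\<in>?P. multiplicity p n)"
    by (auto simp: size_multiset_overloaded_eq count_prime_factorization in_prime_factors_iff intro!: sum.cong)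
  also have "\<dots> \<le> (\<Sum>p\<in>?P. 1 + 2 * (multiplicity p n div 2))"
    by (intro sum_mono) linarith
  also have "\<dots> = card ?P + 2 * (\<Sum>p\<in>?P. multiplicity p n div 2)"
    by (simp only: sum.distrib sum_distrib_left sum_constant of_nat_id mult_1_right)
  finally have "B < (\<Sum>p\<in>?P. multiplicity p n div 2)" using big by linarith
  then have "(2::nat) ^ B < 2 ^ (\<Sum>p\<in>?P. multiplicity p n div 2)" by simp
  also have "\<dots> = (\<Prod>p\<in>?P. 2 ^ (multiplicity p n div 2))" by (simp add: power_sum)
  also have "\<dots> \<le> a"
    unfolding a_def by (intro prod_mono conjI power_mono) (auto simp: in_prime_factors_iff prime_ge_2_nat)
  finally show ?thesis using \<open>a\<^sup>2 dvd n\<close> by blast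
qed

lemma card_many_repeated_prime_factors_le:
  fixes N B :: nat
  shows
  "real (card {n\<in>{1..N}. size (prime_factorization n) > card (prime_factors n) + 2 * B}) \<le> N / 2 ^ B"
proof -
  let ?Z = "{n\<in>{1..N}. size (prime_factorization n) > card (prime_factors n) + 2 * B}"
  have "?Z \<subseteq> (\<Union>a\<in>{2^B<..N}. {n\<in>{1..N}. a\<^sup>2 dvd n})"
  proof
    fix n assume n: "n \<in> ?Z"
    then obtain a where a: "a > 2 ^ B" "a\<^sup>2 dvd n" using exists_large_square_divisor[of n B] by auto
    have "a \<le> a\<^sup>2" by (simp add: power2_nat_le_imp_le)
    also have "\<dots> \<le> n" using a n by (intro dvd_imp_le) auto
    finally show "n \<in> (\<Union>a\<in>{2^B<..N}. {n\<in>{1..N}. a\<^sup>2 dvd n})" using a n by auto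
  qed
  then have "card ?Z \<le> card (\<Union>a\<in>{2^B<..N}. {n\<in>{1..N}. a\<^sup>2 dvd n})" by (intro card_mono) auto
  also have "\<dots> \<le> (\<Sum>a\<in>{2^B<..N}. card {n\<in>{1..N}. a\<^sup>2 dvd n})" by (rule card_UN_le) auto
  finally have "real (card ?Z) \<le> (\<Sum>a\<in>{2^B<..N}. real (card {n\<in>{1..N}. a\<^sup>2 dvd n}))"
    by (simp flip: of_nat_sum)
  also have "\<dots> \<le> (\<Sum>a\<in>{2^B<..N}. N * (1 / (real a)\<^sup>2))"
  proof (rule sum_mono)
    fix a assume "a \<in> {2 ^ B<..N}"
    then have "a\<^sup>2 > 0" by auto
    from card_multiples_le[OF this, of N] show "real (card {n\<in>{1..N}. a\<^sup>2 dvd n}) \<le> N * (1 / (real a)\<^sup>2)"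
      by simp
  qed
  also have "\<dots> = N * (\<Sum>a\<in>{2^B<..N}. 1 / (real a)\<^sup>2)" by (simp add: sum_distrib_left)
  also have "\<dots> \<le> N * (1 / real (2 ^ B))" by (intro mult_left_mono sum_inverse_squares_le) auto
  finally show ?thesis by simp
qed

section \<open>Primes in short multiplicative ranges\<close>

lemma prod_primes_dvd:
  fixes n :: nat
  assumes "finite P" "\<And>p. p \<in> P \<Longrightarrow> prime p" "\<And>p. p \<in> P \<Longrightarrow> p dvd n"
  shows "\<Prod>P dvd n"
  using assms
proof (induction P rule: finite_induct)
  case (insert p P)
  have "coprime p (\<Prod>P)"
    using insert by (intro prod_coprime_right primes_coprime) auto
  then show ?case using insert by (simp add: divides_mult)
qed simp

lemma finite_primes_le [simp]: "finite {p::nat. prime p \<and> p \<le> n}"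
  by (rule finite_subset[of _ "{..n}"]) auto

text \<open>Erdos's argument: for n = 2 * m + 1 the primes between m + 2 and n all divide the
  binomial coefficient of n over m. Base 8 instead of the classical 4 leaves room for bounding that
  coefficient crudely by 2^n.\<close>

lemma primorial_le: "\<Prod>{p::nat. prime p \<and> p \<le> n} \<le> 8 ^ n"
proof (induction n rule: less_induct)
  case (less n)
  consider "n \<le> 1" | "n = 2" | "n > 2" "even n" | "n > 2" "odd n" by linarith
  then show ?case
  proof cases
    case 1
    then have e: "{p::nat. prime p \<and> p \<le> n} = {}" by (auto dest: prime_gt_1_nat)
    show ?thesis unfolding e by simp
  next
    case 2
    then have e: "{p::nat. prime p \<and> p \<le> n} = {2}"
      by (auto intro: order_antisym prime_ge_2_nat)
    show ?thesis unfolding e using 2 by simp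
  next
    case 3
    have "\<not> prime n" using 3 by (metis less_not_refl primes_dvd_imp_eq two_is_prime_nat)
    then have "p \<le> n \<longleftrightarrow> p \<le> n - 1" if "prime p" for p
      using that 3 by (cases "p = n") auto
    then have e: "{p::nat. prime p \<and> p \<le> n} = {p. prime p \<and> p \<le> n - 1}" by auto
    have "\<Prod>{p::nat. prime p \<and> p \<le> n - 1} \<le> 8 ^ (n - 1)" using 3 by (intro less) simp
    also have "(8::nat) ^ (n - 1) \<le> 8 ^ n" by (intro power_increasing) auto
    finally show ?thesis unfolding e .
  next
    case 4
    then obtain m where n: "n = 2 * m + 1" by (elim oddE)
    then have m: "m \<ge> 1" using 4 by simp
    let ?B = "{p. prime p \<and> m + 1 < p \<and> p \<le> n}"
    have "\<Prod>?B dvd (n choose m)"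
    proof (rule prod_primes_dvd)
      show "finite ?B" by (rule finite_subset[of _ "{..n}"]) auto
      fix p assume p: "p \<in> ?B"
      have nm: "n - m = m + 1" "m \<le> n" using n by auto
      have eq: "fact m * fact (m + 1) * (n choose m) = (fact n :: nat)"
        using binomial_fact_lemma[OF nm(2)] unfolding nm(1) .
      have "p dvd fact m * fact (m + 1) * (n choose m)"
        unfolding eq using p by (simp add: prime_dvd_fact_iff)
      moreover have "\<not> p dvd fact m" "\<not> p dvd fact (m + 1)"
        using p by (auto simp: prime_dvd_fact_iff simp del: fact_Suc)
      ultimately show "p dvd (n choose m)" using p by (auto simp: prime_dvd_mult_iff simp del: fact_Suc)
    qed auto
    then have "\<Prod>?B \<le> (n choose m)" using n by (intro dvd_imp_le) (auto simp: zero_less_binomial_iff)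
    also have "\<dots> \<le> 2 ^ n" by (rule binomial_le_pow2)
    finally have B: "\<Prod>?B \<le> 2 ^ n" .
    have "{p. prime p \<and> p \<le> n} = {p. prime p \<and> p \<le> m + 1} \<union> ?B" using n by auto
    moreover have "finite ?B" by (rule finite_subset[of _ "{..n}"]) auto
    ultimately have "\<Prod>{p. prime p \<and> p \<le> n} = \<Prod>{p. prime p \<and> p \<le> m + 1} * \<Prod>?B"
      by (subst prod.union_disjoint[symmetric]) auto
    also have "\<dots> \<le> 8 ^ (m + 1) * 2 ^ n"
      using less[of "m + 1"] B n m by (intro mult_mono) auto
    also have "\<dots> = 2 ^ (3 * (m + 1) + n)" by (simp add: power_add power_mult)
    also have "\<dots> \<le> 2 ^ (3 * n)" using n m by (intro power_increasing) auto
    also have "\<dots> = 8 ^ n" by (simp add: power_mult)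
    finally show ?thesis .
  qed
qed

text \<open>The identity \<open>1 / (m C(n,m)) - 1 / ((m+1) C(n+1,m+1)) = 1 / (m C(n+1,m))\<close> for binomial
  coefficients \<open>C\<close> (Leibniz's harmonic triangle) drives the induction.\<close>

lemma mult_binomial_dvd_common_multiple:
  fixes m d l :: nat
  assumes "m \<ge> 1" "\<And>j. 1 \<le> j \<Longrightarrow> j \<le> m + d \<Longrightarrow> j dvd l"
  shows "m * ((m + d) choose m) dvd l"
proof -
  \<comment> \<open>As integrality of a quotient, the divisibility passes through the subtraction in
    the identity. Both terms there have the smaller \<open>d\<close>, one with \<open>m\<close> and
    one with \<open>Suc m\<close>, so \<open>m\<close> must vary in the induction.\<close>
  have "real l / (m * ((m + d) choose m)) \<in> \<int>"
    using assms
  proof (induction d arbitrary: m)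
    case 0
    then have "m dvd l" by simp
    then show ?case by (auto elim!: dvdE)
  next
    case (Suc d)
    let ?n = "m + d"
    have c0: "real (?n choose m) > 0" "real (Suc ?n choose m) > 0" by (simp_all add: zero_less_binomial_iff)
    have m0: "real m > 0" using Suc.prems by simp
    define x y z where "x = real (?n choose m)" and "y = real (Suc ?n choose m)"
      and "z = real (Suc ?n choose Suc m)"
    have a: "real (Suc m) * z = real (Suc ?n) * x"
      unfolding x_def z_def by (metis Suc_times_binomial_eq mult.commute of_nat_mult)
    have nd: "Suc ?n - m = Suc d" "Suc ?n - 1 = ?n" by auto
    have b: "real (Suc d) * y = real (Suc ?n) * x"
      unfolding x_def y_def using binomial_absorb_comp[of "Suc ?n" m, unfolded nd] by (metis of_nat_mult)
    have "1 / (real m * x) - 1 / (real (Suc m) * z) = real (Suc d) / (real m * (real (Suc ?n) * x))"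
      unfolding a using c0 m0 unfolding x_def[symmetric] by (simp add: divide_simps)
    also have "\<dots> = 1 / (real m * y)"
      using c0 m0 unfolding b[symmetric] y_def[symmetric] by (simp add: divide_simps)
    finally have "real l * (1 / (real m * y)) = real l * (1 / (real m * x)) - real l * (1 / (real (Suc m) * z))"
      by (metis right_diff_distrib)
    then have e: "real l / (real m * y) = real l / (real m * x) - real l / (real (Suc m) * z)"
      by simp
    have "real l / (m * ((m + d) choose m)) \<in> \<int>" using Suc.prems by (intro Suc.IH) auto
    moreover have "real l / (Suc m * ((Suc m + d) choose Suc m)) \<in> \<int>"
      using Suc.prems by (intro Suc.IH) auto
    ultimately show ?case using e unfolding x_def y_def z_def
      by (metis Ints_diff add_Suc add_Suc_right of_nat_mult)
  qed
  then obtain z :: int where z: "real l / (m * ((m + d) choose m)) = of_int z" by (elim Ints_cases)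
  have "m * ((m + d) choose m) > 0" using assms by (simp add: zero_less_binomial_iff)
  then have "real l = of_int z * real (m * ((m + d) choose m))"
    using z by (simp add: divide_eq_eq)
  then have "real_of_int (int l) = real_of_int (z * int (m * ((m + d) choose m)))"
    by (simp del: of_nat_mult add: of_nat_mult[symmetric]) 
  then have "int l = z * int (m * ((m + d) choose m))" by (simp only: of_int_eq_iff)
  then have "int (m * ((m + d) choose m)) dvd int l" by simp
  then show ?thesis by (simp only: int_dvd_int_iff)
qed

lemma prime_power_multiplicity_Lcm_le:
  assumes "prime p" "n \<ge> 1"
  shows "p ^ multiplicity p (Lcm {1..n}) \<le> (n::nat)"
  using assms(2)
proof (induction n rule: dec_induct)
  case (step n)
  have "Lcm {1..n} \<noteq> 0" by (subst Lcm_0_iff) auto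
  have "{1..Suc n} = insert (Suc n) {1..n}" by auto
  then have "Lcm {1..Suc n} = lcm (Suc n) (Lcm {1..n})" by simp
  then have "multiplicity p (Lcm {1..Suc n}) = max (multiplicity p (Suc n)) (multiplicity p (Lcm {1..n}))"
    using \<open>Lcm {1..n} \<noteq> 0\<close> assms by (simp add: multiplicity_lcm)
  moreover have "p ^ multiplicity p (Suc n) \<le> Suc n" by (intro dvd_imp_le multiplicity_dvd) auto
  ultimately show ?case using step by (auto simp: max_def)
qed simp

text \<open>This takes the place of Legendre's formula: the coefficient divides the lcm of 1, ..., 2
  * m, and no prime power in that lcm exceeds 2 * m.\<close>

lemma prime_power_multiplicity_central_binomial_le:
  assumes "prime p" "m \<ge> 1"
  shows "p ^ multiplicity p ((2 * m) choose m) \<le> 2 * m"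
proof -
  have "m * ((m + m) choose m) dvd Lcm {1..2 * m}"
    using assms by (intro mult_binomial_dvd_common_multiple dvd_Lcm) auto
  then have "((2 * m) choose m) dvd Lcm {1..2 * m}" by (metis dvd_mult_right mult_2)
  moreover have "Lcm {1..2 * m} \<noteq> 0" by (subst Lcm_0_iff) auto
  ultimately have "multiplicity p ((2 * m) choose m) \<le> multiplicity p (Lcm {1..2 * m})"
    by (intro dvd_imp_multiplicity_le)
  then have "p ^ multiplicity p ((2 * m) choose m) \<le> p ^ multiplicity p (Lcm {1..2 * m})"
    using assms by (intro power_increasing) (auto simp: prime_ge_Suc_0_nat)
  also have "\<dots> \<le> 2 * m" using assms by (intro prime_power_multiplicity_Lcm_le) auto
  finally show ?thesis .
qed

text \<open>Split the prime powers of the coefficient. If p^2 \<le> 2 * m, bound the power by 2 * m.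
  A larger prime occurs only once, so those up to \<open>Y\<close> are bounded together by the
  primorial, and those above \<open>Y\<close> by 2 * m each.\<close>

lemma central_binomial_le_prime_counts:
  assumes m: "m \<ge> 1"
  shows "(2 * m) choose m \<le> (2 * m) ^ card {p. p \<noteq> 0 \<and> p\<^sup>2 \<le> 2 * m} * 8 ^ Y *
     (2 * m) ^ card {p. prime p \<and> Y < p \<and> p \<le> 2 * m}"
proof -
  let ?C = "(2 * m) choose m" and ?n = "2 * m"
  let ?P = "prime_factors ?C"
  let ?A = "{p. p \<noteq> 0 \<and> p\<^sup>2 \<le> ?n}" and ?B = "{p. prime p \<and> p \<le> Y}" and ?D = "{p. prime p \<and> Y < p \<and> p \<le> ?n}"
  define f where "f p = p ^ multiplicity p ?C" for p
  have C0: "?C > 0" by (simp add: zero_less_binomial_iff)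
  have pr: "prime p" if "p \<in> ?P" for p using that by (simp add: in_prime_factors_iff)
  have f: "f p \<le> ?n" "p \<le> f p" "1 \<le> f p" if "p \<in> ?P" for p
  proof -
    show "f p \<le> ?n" unfolding f_def using pr[OF that] m by (rule prime_power_multiplicity_central_binomial_le)
    have "multiplicity p ?C > 0" using that C0 pr[OF that] by (simp add: prime_multiplicity_gt_zero_iff in_prime_factors_iff)
    then show "p \<le> f p" unfolding f_def using pr[OF that] by (metis One_nat_def Suc_leI power_increasing power_one_right prime_ge_1_nat)
    then show "1 \<le> f p" using pr[OF that] prime_ge_1_nat[of p] by linarith
  qed
  have finA: "finite ?A"
    by (rule finite_subset[of _ "{..?n}"]) (auto simp: power2_eq_square intro: order_trans[OF le_square])
  have finD: "finite ?D" by (rule finite_subset[of _ "{..?n}"]) auto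
  have fB: "f p \<le> p" if p: "p \<in> ?P - ?A" for p
  proof -
    have "multiplicity p ?C \<le> 1"
    proof (rule ccontr)
      assume "\<not> multiplicity p ?C \<le> 1"
      then have "p\<^sup>2 \<le> f p" unfolding f_def using pr[of p] p by (intro power_increasing) (auto simp: prime_ge_Suc_0_nat)
      then show False using f(1)[of p] p pr[of p] by (auto simp: prime_gt_0_nat)
    qed
    then show ?thesis unfolding f_def using pr[of p] p power_increasing[of "multiplicity p ?C" 1 p]
      by (auto simp: prime_ge_Suc_0_nat)
  qed
  have "?C = (\<Prod>p\<in>?P. f p)" unfolding f_def using C0 by (intro prime_factorization_nat)
  also have "\<dots> = (\<Prod>p\<in>?P \<inter> ?A. f p) * (\<Prod>p\<in>?P - ?A. f p)"
    by (subst prod.union_disjoint[symmetric]) (auto intro!: prod.cong)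
  also have "(\<Prod>p\<in>?P - ?A. f p) = (\<Prod>p\<in>(?P - ?A) \<inter> ?B. f p) * (\<Prod>p\<in>(?P - ?A) - ?B. f p)"
    by (subst prod.union_disjoint[symmetric]) (auto intro!: prod.cong)
  also have "(\<Prod>p\<in>?P \<inter> ?A. f p) \<le> ?n ^ card ?A"
  proof -
    have "(\<Prod>p\<in>?P \<inter> ?A. f p) \<le> (\<Prod>p\<in>?P \<inter> ?A. ?n)" using f by (intro prod_mono) auto
    also have "\<dots> = ?n ^ card (?P \<inter> ?A)" by simp
    also have "\<dots> \<le> ?n ^ card ?A" using m finA by (intro power_increasing card_mono) auto
    finally show ?thesis .
  qed
  also have "(\<Prod>p\<in>(?P - ?A) \<inter> ?B. f p) \<le> 8 ^ Y"
  proof -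
    have "(\<Prod>p\<in>(?P - ?A) \<inter> ?B. f p) \<le> \<Prod>((?P - ?A) \<inter> ?B)" using fB by (intro prod_mono) auto
    also have "\<dots> \<le> \<Prod>?B"
      by (intro dvd_imp_le prod_dvd_prod_subset prod_pos) (auto simp: prime_gt_0_nat)
    also have "\<dots> \<le> 8 ^ Y" by (rule primorial_le)
    finally show ?thesis .
  qed
  also have "(\<Prod>p\<in>(?P - ?A) - ?B. f p) \<le> ?n ^ card ?D"
  proof -
    have "(\<Prod>p\<in>(?P - ?A) - ?B. f p) \<le> (\<Prod>p\<in>(?P - ?A) - ?B. ?n)" using f by (intro prod_mono) auto
    also have "\<dots> = ?n ^ card ((?P - ?A) - ?B)" by simp
    also have "\<dots> \<le> ?n ^ card ?D"
    proof (intro power_increasing card_mono finD)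
      show "(?P - ?A) - ?B \<subseteq> ?D" using f pr by (auto simp: not_le intro: order_trans)
    qed (use m in auto)
    finally show ?thesis .
  qed
  finally show ?thesis by (simp add: mult_ac)
qed

lemma card_squares_le: "real (card {p::nat. p \<noteq> 0 \<and> p\<^sup>2 \<le> n}) \<le> sqrt n"
proof -
  have "{p::nat. p \<noteq> 0 \<and> p\<^sup>2 \<le> n} \<subseteq> {1..nat \<lfloor>sqrt n\<rfloor>}"
  proof
    fix p assume p: "p \<in> {p::nat. p \<noteq> 0 \<and> p\<^sup>2 \<le> n}"
    then have "(real p)\<^sup>2 \<le> real n" by (metis (mono_tags, lifting) mem_Collect_eq of_nat_le_iff of_nat_power)
    then have "real p \<le> sqrt n" by (rule real_le_rsqrt)
    with p show "p \<in> {1..nat \<lfloor>sqrt n\<rfloor>}" by (auto simp: le_nat_floor)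
  qed
  then have "card {p::nat. p \<noteq> 0 \<and> p\<^sup>2 \<le> n} \<le> card {1..nat \<lfloor>sqrt n\<rfloor>}" by (intro card_mono) auto
  then have "card {p::nat. p \<noteq> 0 \<and> p\<^sup>2 \<le> n} \<le> nat \<lfloor>sqrt n\<rfloor>" by simp
  moreover have "real (nat \<lfloor>sqrt n\<rfloor>) \<le> sqrt n" by (intro of_nat_floor) simp
  ultimately show ?thesis by linarith
qed

text \<open>The coefficient is at least 4^m / (2 * m). The primes up to Y \<le> m / 4 account for at
  most 8^(m/4), so of 2 * m factors 2 a number 2 * m - 3 * m / 4 = 5 * m / 4 remains. The summand 1
  comes from the denominator 2 * m.\<close>

lemma card_primes_lower_bound:
  fixes m Y :: nat
  assumes m: "m \<ge> 1" and Y: "4 * Y \<le> m"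
  shows "5 / 4 * m * ln 2 \<le> (card {p. prime p \<and> Y < p \<and> p \<le> 2 * m} + sqrt (2 * m) + 1) * ln (2 * m)"
proof -
  let ?N = "card {p. prime p \<and> Y < p \<and> p \<le> 2 * m}" and ?a = "card {p. p \<noteq> 0 \<and> p\<^sup>2 \<le> 2 * m}"
  have m2: "ln (real (2 * m)) \<ge> 0" using m by simp
  have "4 ^ m / (2 * real m) \<le> real ((2 * m) choose m)"
    using m by (intro central_binomial_lower_bound) auto
  also have "\<dots> \<le> real ((2 * m) ^ ?a * 8 ^ Y * (2 * m) ^ ?N)"
    using central_binomial_le_prime_counts[OF m, of Y] by (simp only: of_nat_le_iff)
  also have "\<dots> = real (2 * m) ^ (?a + ?N) * 8 ^ Y" by (simp add: power_add)
  finally have "4 ^ m \<le> real (2 * m) ^ (?a + ?N + 1) * 8 ^ Y"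
    using m by (simp add: divide_le_eq mult_ac)
  then have "ln (4 ^ m) \<le> ln (real (2 * m) ^ (?a + ?N + 1) * 8 ^ Y)"
    using m by (subst ln_le_cancel_iff) auto
  also have "\<dots> = (?a + ?N + 1) * ln (real (2 * m)) + Y * ln 8"
    using m by (subst ln_mult) (auto simp: ln_realpow simp del: of_nat_mult power_Suc)
  also have "\<dots> \<le> (?N + sqrt (2 * m) + 1) * ln (real (2 * m)) + (m / 4) * ln 8"
    using card_squares_le[of "2 * m"] Y m2 by (intro add_mono mult_right_mono) auto
  finally have *: "m * ln 4 \<le> (?N + sqrt (2 * m) + 1) * ln (real (2 * m)) + (m / 4) * ln 8"
    by (simp add: ln_realpow)
  have "ln (4::real) = 2 * ln 2" "ln (8::real) = 3 * ln 2"
    using ln_realpow[of 2 2] ln_realpow[of 2 3] by simp_all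
  with * show ?thesis by (simp add: algebra_simps)
qed

lemma eventually_card_primes_ge:
  "\<forall>\<^sub>F y::real in at_top. y / (4 * ln y) \<le> card {p::nat. prime p \<and> y / 16 < p \<and> p \<le> y}"
proof -
  \<comment> \<open>The main terms are y / 4 on the left and 5 * y / 16 on the right. This margin
    allows the crude estimate ln 2 \<ge> 1 / 2.\<close>
  have "\<forall>\<^sub>F y::real in at_top. (y / (4 * ln y) + sqrt y + 1) * ln y \<le> 5 / 4 * (y / 2 - 1) * (1 / 2)"
    by real_asymp
  then show ?thesis
    using eventually_ge_at_top[of 100]
  proof eventually_elim
    case (elim y)
    define m where "m = nat \<lfloor>y / 2\<rfloor>"
    define Y where "Y = m div 4"
    have mb: "real m \<le> y / 2" "y / 2 - 1 < real m" using elim unfolding m_def by linarith+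
    have m1: "m \<ge> 1" using mb elim by linarith
    let ?N = "card {p. prime p \<and> Y < p \<and> p \<le> 2 * m}"
    have "{p. prime p \<and> Y < p \<and> p \<le> 2 * m} \<subseteq> {p::nat. prime p \<and> y / 16 < p \<and> p \<le> y}"
    proof (safe, goal_cases)
      case (1 p)
      then have "m < 4 * p" unfolding Y_def by linarith
      then show ?case using mb elim by linarith
    next
      case (2 p)
      then show ?case using mb by linarith
    qed
    moreover have "finite {p::nat. prime p \<and> y / 16 < p \<and> p \<le> y}"
      by (rule finite_subset[of _ "{..nat \<lfloor>y\<rfloor>}"]) (auto simp: le_nat_floor)
    ultimately have N: "?N \<le> card {p::nat. prime p \<and> y / 16 < p \<and> p \<le> y}" by (intro card_mono)
    have ly: "ln y > 0" using elim by simp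
    have "ln (2::real) \<ge> 1 / 2" using ln_le_minus_one[of "1 / 2"] by (simp add: ln_div)
    have "(y / (4 * ln y) + sqrt y + 1) * ln y \<le> 5 / 4 * (y / 2 - 1) * (1 / 2)" using elim by simp
    also have "\<dots> \<le> 5 / 4 * m * ln 2"
      using mb elim \<open>ln 2 \<ge> 1 / 2\<close> by (intro mult_mono) auto
    also have "\<dots> \<le> (?N + sqrt (2 * m) + 1) * ln (2 * m)"
      using card_primes_lower_bound[OF m1, of Y] by (simp add: Y_def)
    also have "\<dots> \<le> (?N + sqrt y + 1) * ln y"
      using mb m1 by (intro mult_mono add_mono) auto
    finally have "y / (4 * ln y) + sqrt y + 1 \<le> ?N + sqrt y + 1"
      using ly by (simp add: mult_le_cancel_right_pos)
    then show ?case using N by linarith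
  qed
qed

section \<open>Large families from chains of primes\<close>

text \<open>The residue modulo the prime chosen from \<open>P i\<close> encodes the prime chosen from \<open>P (Suc i)\<close>, so two
  chains disagree modulo the last prime before they branch.\<close>

lemma admits_disjoint_classes_prime_chains:
  fixes P :: "nat \<Rightarrow> nat set"
  assumes fin: "\<And>i. i < K \<Longrightarrow> finite (P i)"
    and prm: "\<And>i p. i < K \<Longrightarrow> p \<in> P i \<Longrightarrow> prime p"
    and disj: "\<And>i j. i < K \<Longrightarrow> j < K \<Longrightarrow> i \<noteq> j \<Longrightarrow> P i \<inter> P j = {}"
    and one: "card (P 0) \<le> 1"
    and code: "\<And>i p. Suc i < K \<Longrightarrow> p \<in> P i \<Longrightarrow> card (P (Suc i)) \<le> p"
  defines "M \<equiv> (\<lambda>f. \<Prod>i<K. f i) ` (\<Pi>\<^sub>E i\<in>{..<K}. P i)"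
  shows "card M = (\<Prod>i<K. card (P i))" "admits_disjoint_classes M"
proof -
  define \<Pi>f where "\<Pi>f f = (\<Prod>i<K. f i)" for f :: "nat \<Rightarrow> nat"
  let ?F = "\<Pi>\<^sub>E i\<in>{..<K}. P i"
  have key: "p dvd \<Pi>f f \<longleftrightarrow> p = f i" if f: "f \<in> ?F" and i: "i < K" and p: "p \<in> P i" for f i p
  proof
    assume "p dvd \<Pi>f f"
    then have "\<exists>j\<in>{..<K}. p dvd f j"
      unfolding \<Pi>f_def using prm[OF i p] by (subst (asm) prime_dvd_prod_iff) auto
    then obtain j where j: "j < K" "p dvd f j" by auto
    have fj: "f j \<in> P j" using f j by auto
    then have "p = f j" using prm[OF i p] prm[OF j(1) fj] j(2) by (simp add: primes_dvd_imp_eq)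
    moreover from this have "i = j" using disj[OF i j(1)] p fj by auto
    ultimately show "p = f i" by simp
  next
    assume "p = f i"
    then show "p dvd \<Pi>f f" unfolding \<Pi>f_def using i by auto
  qed
  have inj: "inj_on \<Pi>f ?F"
  proof (rule inj_onI)
    fix f g assume f: "f \<in> ?F" and g: "g \<in> ?F" and eq: "\<Pi>f f = \<Pi>f g"
    show "f = g"
    proof (rule PiE_ext[OF f g])
      fix i assume "i \<in> {..<K}"
      then have i: "i < K" and fi: "f i \<in> P i" using f by auto
      show "f i = g i" using key[OF f i fi] key[OF g i fi] eq by simp
    qed
  qed
  have M: "M = \<Pi>f ` ?F" unfolding M_def \<Pi>f_def ..
  show "card M = (\<Prod>i<K. card (P i))"
    unfolding M card_image[OF inj] by (simp add: card_PiE)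
  have "\<exists>e. inj_on e (P i) \<and> e ` P i \<subseteq> {..<card (P i)}" if "i < K" for i
    using ex_bij_betw_finite_nat[OF fin[OF that]] by (metis atLeast0LessThan bij_betw_def order_refl)
  then obtain e :: "nat \<Rightarrow> nat \<Rightarrow> nat"
    where e: "\<And>i. i < K \<Longrightarrow> inj_on (e i) (P i)" "\<And>i. i < K \<Longrightarrow> e i ` P i \<subseteq> {..<card (P i)}"
    by metis
  have "\<exists>y. \<forall>i\<in>{i. Suc i < K}. [y = e (Suc i) (f (Suc i))] (mod f i)" if f: "f \<in> ?F" for f
  proof (rule chinese_remainder_nat)
    show "finite {i. Suc i < K}" by (rule finite_subset[of _ "{..K}"]) auto
    show "\<forall>i\<in>{i. Suc i < K}. \<forall>j\<in>{i. Suc i < K}. i \<noteq> j \<longrightarrow> coprime (f i) (f j)"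
    proof (intro ballI impI)
      fix i j assume ij: "i \<in> {i. Suc i < K}" "j \<in> {i. Suc i < K}" "i \<noteq> j"
      then have K: "i < K" "j < K" by auto
      have fij: "f i \<in> P i" "f j \<in> P j" using f K by auto
      have "f i \<noteq> f j" using disj[OF K ij(3)] fij by auto
      then show "coprime (f i) (f j)"
        by (rule primes_coprime[OF prm[OF K(1) fij(1)] prm[OF K(2) fij(2)]])
    qed
  qed
  then obtain y where y: "\<And>f i. f \<in> ?F \<Longrightarrow> Suc i < K \<Longrightarrow> [y f = e (Suc i) (f (Suc i))] (mod f i)"
    by (metis (mono_tags, lifting) mem_Collect_eq)
  define a where "a m = int (y (the_inv_into ?F \<Pi>f m))" for m
  have a: "a (\<Pi>f f) = int (y f)" if "f \<in> ?F" for f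
    using that inj by (simp add: a_def the_inv_into_f_f)
  have "disjoint_family_on (\<lambda>m. residue_class (a m) m) M"
    unfolding disjoint_family_on_def
  proof (intro ballI impI equals0I)
    fix m m' z assume m: "m \<in> M" "m' \<in> M" "m \<noteq> m'"
      and z: "z \<in> residue_class (a m) m \<inter> residue_class (a m') m'"
    obtain f g where f: "f \<in> ?F" "m = \<Pi>f f" and g: "g \<in> ?F" "m' = \<Pi>f g" using m by (auto simp: M)
    have "\<exists>i. i < K \<and> f i \<noteq> g i"
    proof (rule ccontr)
      assume "\<not> ?thesis"
      then have "f = g" by (intro PiE_ext[OF f(1) g(1)]) auto
      then show False using f g m by simp
    qed
    then obtain i where i: "i < K" "f i \<noteq> g i" and least: "\<And>j. j < i \<Longrightarrow> \<not> (j < K \<and> f j \<noteq> g j)"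
      using exists_least_iff[of "\<lambda>i. i < K \<and> f i \<noteq> g i"] by metis
    have fgi: "f i \<in> P i" "g i \<in> P i" using f g i by auto
    \<comment> \<open>The first block offers no choice, so a first difference always has a common
      prime before it.\<close>
    have "i \<noteq> 0"
    proof
      assume "i = 0"
      then have "card {f i, g i} \<le> card (P 0)" using fgi fin[OF i(1)] by (intro card_mono) auto
      then show False using one i by simp
    qed
    then obtain j where j: "i = Suc j" by (cases i) auto
    have fg: "f j = g j" using least[of j] i j by auto
    let ?p = "f j"
    have jK: "j < K" using i(1) j by simp
    have pP: "?p \<in> P j" by (rule PiE_mem[OF f(1)]) (use jK in simp)
    have "[z = int (y f)] (mod int ?p)" "[z = int (y g)] (mod int ?p)"
    proof -
      have "?p dvd m" "?p dvd m'"
        using key[OF f(1) jK pP] key[OF g(1) jK pP] fg unfolding f(2) g(2) by simp_all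
      then show "[z = int (y f)] (mod int ?p)" "[z = int (y g)] (mod int ?p)"
        using z unfolding f(2) g(2) a[OF f(1)] a[OF g(1)]
        by (auto simp: residue_class_def intro: cong_dvd_modulus)
    qed
    then have "[y f = y g] (mod ?p)" by (metis cong_int_iff cong_sym cong_trans)
    moreover have "[y f = e i (f i)] (mod ?p)" "[y g = e i (g i)] (mod ?p)"
      using y[OF f(1), of j] y[OF g(1), of j] i(1) fg unfolding j by simp_all
    ultimately have "[e i (f i) = e i (g i)] (mod ?p)" by (meson cong_sym cong_trans)
    \<comment> \<open>Codes lie below \<open>card (P i)\<close>, which is at most the common prime,
      so congruent codes are equal.\<close>
    moreover have "e i (f i) < ?p" "e i (g i) < ?p"
    proof -
      have "card (P i) \<le> ?p" using code[of j ?p] i(1) pP unfolding j by simp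
      moreover have "e i (f i) < card (P i)" "e i (g i) < card (P i)"
        using e(2)[OF i(1)] fgi by (simp_all add: image_subset_iff)
      ultimately show "e i (f i) < ?p" "e i (g i) < ?p" by simp_all
    qed
    ultimately have "e i (f i) = e i (g i)" by (simp add: cong_less_modulus_unique_nat)
    then show False using e(1)[OF i(1)] fgi i by (auto dest: inj_onD)
  qed
  then show "admits_disjoint_classes M" unfolding admits_disjoint_classes_def by blast
qed

lemma card_le_max_disjoint_classes:
  assumes "M \<subseteq> {m. 2 \<le> m \<and> real m \<le> x}" "admits_disjoint_classes M"
  shows "card M \<le> max_disjoint_classes x"
  unfolding max_disjoint_classes_def
  using assms by (intro Max_ge max_disjoint_classes_wf) auto

lemma floor_nat_ge_half:
  assumes "x \<ge> (1::real)"
  shows "x / 2 \<le> real (nat \<lfloor>x\<rfloor>)"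
proof -
  have f: "\<lfloor>x\<rfloor> \<ge> 1" using assms by (simp add: le_floor_iff)
  then have "real_of_int \<lfloor>x\<rfloor> \<ge> 1" by linarith
  moreover have "x < real_of_int \<lfloor>x\<rfloor> + 1" by linarith
  moreover have "real (nat \<lfloor>x\<rfloor>) = real_of_int \<lfloor>x\<rfloor>" using f by simp
  ultimately show ?thesis by linarith
qed

text \<open>Block \<open>i\<close> consists of primes just below \<open>\<rho> ^ Suc i\<close>, as many as the residues modulo a prime of
  the previous block can encode.\<close>

lemma max_disjoint_classes_ge_of_prime_density:
  fixes \<rho> x :: real
  assumes K: "K \<ge> 1" and \<rho>: "\<rho> \<ge> 32" and x: "x = (\<Prod>i<K. \<rho> ^ Suc i)"
    and dens: "\<And>i. i < K \<Longrightarrow> 1 / 16 * \<rho> ^ i \<le> card {p::nat. prime p \<and> \<rho> ^ Suc i / 16 < p \<and> p \<le> \<rho> ^ Suc i}"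
  shows "x / (32 * \<rho>) ^ K \<le> max_disjoint_classes x"
proof -
  define A where "A i = {p::nat. prime p \<and> \<rho> ^ Suc i / 16 < p \<and> p \<le> \<rho> ^ Suc i}" for i
  \<comment> \<open>Primes of block \<open>i - 1\<close> exceed \<rho>^i / 16, so this many codes
    fit below each of them. Block 0 has no predecessor to record a choice and gets a single
    prime.\<close>
  define n where "n i = (if i = 0 then 1 else nat \<lfloor>\<rho> ^ i / 16\<rfloor>)" for i :: nat
  have finA: "finite (A i)" for i
    by (rule finite_subset[of _ "{..nat \<lfloor>\<rho> ^ Suc i\<rfloor>}"]) (auto simp: A_def le_nat_floor)
  have nA: "n i \<le> card (A i)" if "i < K" for i
  proof (cases "i = 0")
    case True
    then have "real (card (A i)) > 0" using dens[OF that] by (simp add: A_def)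
    then show ?thesis using True by (simp add: n_def)
  next
    case False
    then have "n i = nat \<lfloor>\<rho> ^ i / 16\<rfloor>" by (simp add: n_def)
    moreover have "\<rho> ^ i / 16 \<le> real (card (A i))" using dens[OF that] by (simp add: A_def)
    ultimately show ?thesis by linarith
  qed
  have "\<exists>T. T \<subseteq> A i \<and> card T = n i" if "i < K" for i
    by (rule obtain_subset_with_card_n[OF nA[OF that]]) blast
  then obtain P where P: "\<And>i. i < K \<Longrightarrow> P i \<subseteq> A i" "\<And>i. i < K \<Longrightarrow> card (P i) = n i"
    by metis
  define M where "M = (\<lambda>f. \<Prod>i<K. f i) ` (\<Pi>\<^sub>E i\<in>{..<K}. P i)"
  have prm: "prime p" "\<rho> ^ Suc i / 16 < p" "p \<le> \<rho> ^ Suc i" if "i < K" "p \<in> P i" for i p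
    using P(1)[OF that(1)] that(2) by (auto simp: A_def)
  have sep: "P i \<inter> P j = {}" if ij: "i < K" "j < K" "i < j" for i j
  proof (rule equals0I)
    fix p assume p: "p \<in> P i \<inter> P j"
    have "\<rho> ^ Suc i \<le> \<rho> ^ j" using ij \<rho> by (intro power_increasing) auto
    \<comment> \<open>\<rho> is larger than 16, so the ranges of different blocks cannot
      overlap.\<close>
    also have "\<dots> \<le> \<rho> ^ Suc j / 16" using \<rho> by simp
    also have "\<dots> < p" by (rule prm(2)) (use ij p in auto)
    also have "real p \<le> \<rho> ^ Suc i" by (rule prm(3)) (use ij p in auto)
    finally show False by simp
  qed
  have *: "card M = (\<Prod>i<K. card (P i))" "admits_disjoint_classes M"
  proof -
    have 1: "finite (P i)" if "i < K" for i using P(1)[OF that] finA by (rule finite_subset)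
    have 3: "P i \<inter> P j = {}" if "i < K" "j < K" "i \<noteq> j" for i j
      using sep[of i j] sep[of j i] that by (cases "i < j") auto
    have 4: "card (P 0) \<le> 1" using P(2)[of 0] K by (simp add: n_def)
    have 5: "card (P (Suc i)) \<le> p" if "Suc i < K" "p \<in> P i" for i p
    proof -
      have "real (card (P (Suc i))) = real (nat \<lfloor>\<rho> ^ Suc i / 16\<rfloor>)" using P(2)[OF that(1)] by (simp add: n_def)
      also have "\<dots> \<le> \<rho> ^ Suc i / 16" using \<rho> by (intro of_nat_floor) simp
      also have "\<dots> < p" using prm(2)[of i p] that by simp
      finally show ?thesis by simp
    qed
    show "card M = (\<Prod>i<K. card (P i))" "admits_disjoint_classes M"
      unfolding M_def using admits_disjoint_classes_prime_chains[of K P, OF 1 prm(1) 3 4 5] by auto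
  qed
  have "M \<subseteq> {m. 2 \<le> m \<and> real m \<le> x}"
  proof (clarsimp simp: M_def, intro conjI)
    fix f assume f: "f \<in> (\<Pi>\<^sub>E i\<in>{..<K}. P i)"
    have fi: "f i \<in> P i" if "i < K" for i using f that by auto
    have "2 \<le> f 0" using prm(1)[of 0] fi[of 0] K prime_ge_2_nat by auto
    also have "f 0 dvd (\<Prod>i<K. f i)" using K by (intro dvd_prodI) auto
    then have "f 0 \<le> (\<Prod>i<K. f i)"
      using fi prm(1) by (intro dvd_imp_le prod_pos) (auto intro: prime_gt_0_nat)
    finally show "2 \<le> prod f {..<K}" .
    show "(\<Prod>i<K. real (f i)) \<le> x"
      unfolding x using prm(3) fi by (intro prod_mono) auto
  qed
  from card_le_max_disjoint_classes[OF this *(2)] have "real (card M) \<le> real (max_disjoint_classes x)" by simp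
  moreover have "x / (32 * \<rho>) ^ K \<le> real (card M)"
  proof -
    have "x / (32 * \<rho>) ^ K = (\<Prod>i<K. \<rho> ^ Suc i / (32 * \<rho>))"
      unfolding x by (simp only: prod_dividef prod_constant card_lessThan)
    also have "\<dots> \<le> (\<Prod>i<K. real (card (P i)))"
    proof (intro prod_mono conjI)
      fix i assume i: "i \<in> {..<K}"
      show "0 \<le> \<rho> ^ Suc i / (32 * \<rho>)" using \<rho> by simp
      \<comment> \<open>The 32 is 16 from the number of codes times 2 for rounding down.\<close>
      have e: "\<rho> ^ Suc i / (32 * \<rho>) = (\<rho> ^ i / 16) / 2" using \<rho> by simp
      show "\<rho> ^ Suc i / (32 * \<rho>) \<le> real (card (P i))"
      proof (cases "i = 0")
        case False
        then have "\<rho> ^ 1 \<le> \<rho> ^ i" using \<rho> by (intro power_increasing) auto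
        then have "\<rho> ^ i / 16 \<ge> 1" using \<rho> by simp
        from floor_nat_ge_half[OF this] show ?thesis
          unfolding e using P(2)[of i] i False by (simp add: n_def)
      next
        case True
        then have "card (P i) = 1" using P(2)[of i] i by (simp add: n_def)
        then show ?thesis unfolding e using True by simp
      qed
    qed
    also have "\<dots> = real (card M)" using *(1) by simp
    finally show ?thesis .
  qed
  ultimately show ?thesis by linarith
qed

section \<open>Asymptotics\<close>

lemma L_powr: "L x powr a = exp (a * sqrt (ln x * ln (ln x)))"
  by (simp add: L_def powr_def)

text \<open>This is the Chinese remainder theorem for moduli that need not be coprime. Its
  contrapositive is how disjointness enters the counting bound.\<close>

lemma residue_classes_meet:
  assumes "[a = b] (mod int (gcd m n))"
  shows "residue_class a m \<inter> residue_class b n \<noteq> {}"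
proof -
  obtain u v where uv: "u * int m + v * int n = gcd (int m) (int n)" using bezout_int by blast
  obtain k where k: "a - b = int (gcd m n) * k" using assms by (auto simp: cong_iff_dvd_diff)
  define z where "z = a - u * int m * k"
  have "z - a = int m * (- u * k)" by (simp add: z_def)
  moreover have "z - b = int n * (v * k)"
  proof -
    have "z - b = (u * int m + v * int n) * k - u * int m * k" using k unfolding z_def uv by simp
    then show ?thesis by (simp add: algebra_simps)
  qed
  ultimately have "[z = a] (mod int m)" "[z = b] (mod int n)"
    by (auto simp: cong_iff_dvd_diff)
  then show ?thesis by (auto simp: residue_class_def)
qed

lemma exp_half_le_two_power: "exp (real n / 2) \<le> 2 ^ n"
proof -
  have "ln (2::real) \<ge> 1 / 2" using ln_le_minus_one[of "1 / 2"] by (simp add: ln_div)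
  then have "real n * (1 / 2) \<le> real n * ln 2" by (intro mult_left_mono) auto
  then have "exp (real n / 2) \<le> exp (real n * ln 2)" by simp
  also have "\<dots> = 2 ^ n" by (simp add: exp_of_nat_mult)
  finally show ?thesis .
qed

text \<open>Use about \<open>s\<close> divisor slots. For s = sqrt (ln x / ln (ln x)) the harmonic
  sums cost about l = s * ln (ln x), while 8 * s * ln s is about 4 * l because ln s is about ln (ln
  x) / 2. The net exponent is near -3 * l, below the -2 * l needed later.\<close>

lemma card_many_prime_factors_le_exp:
  fixes x s :: real and N k :: nat
  assumes N: "N \<ge> 1" "real N \<le> x" and s: "s \<ge> 1" and k: "8 * s \<le> real k"
  shows "real (card {n\<in>{1..N}. k \<le> card (prime_factors n)}) \<le> x * exp (s * ln (1 + ln x) - 8 * s * ln s)"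
proof -
  define m where "m = nat \<lfloor>s\<rfloor>"
  have m: "real m \<le> s" "s \<le> real m + 1" using s unfolding m_def by linarith+
  let ?c = "real (card {n\<in>{1..N}. k \<le> card (prime_factors n)})"
  have x1: "x \<ge> 1" using N by simp
  have lnN: "0 \<le> ln (real N)" "ln (real N) \<le> ln x" using N by auto
  have "8 * s * ln s \<le> real k * ln s" using k s by (intro mult_right_mono) auto
  moreover have "exp (real k * ln s) = s ^ k" using s by (simp add: exp_of_nat_mult)
  ultimately have "exp (8 * s * ln s) \<le> s ^ k" by (metis exp_le_cancel_iff)
  also have "\<dots> \<le> (real m + 1) ^ k" using m s by (intro power_mono) auto
  finally have "?c * exp (8 * s * ln s) \<le> ?c * (real m + 1) ^ k" by (intro mult_left_mono) auto
  also have "\<dots> \<le> N * (1 + ln N) ^ m"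
    using card_many_prime_factors_le[OF N(1), of k m] by (simp add: add.commute)
  also have "\<dots> \<le> x * (1 + ln x) ^ m"
    using N lnN x1 by (intro mult_mono power_mono) auto
  also have "(1 + ln x) ^ m = exp (real m * ln (1 + ln x))"
    using x1 lnN by (simp add: exp_of_nat_mult)
  also have "x * \<dots> \<le> x * exp (s * ln (1 + ln x))"
    using m x1 lnN by (intro mult_left_mono) (auto intro!: mult_right_mono)
  finally show ?thesis by (simp add: exp_diff field_simps)
qed

text \<open>One \<epsilon> is the deficit allowed in \<open>card M\<close>, one is spent on the
  weight bound exp(\<epsilon> * l), and the third beats the factor 2 lost by discarding moduli with
  too many prime factors.\<close>

lemma eventually_exists_large_gcd:
  fixes \<epsilon> :: real
  assumes \<epsilon>: "0 < \<epsilon>" "\<epsilon> \<le> 1"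
  shows "\<forall>\<^sub>F x in at_top. \<forall>M. M \<subseteq> {q. 1 \<le> q \<and> real q \<le> x} \<longrightarrow> admits_disjoint_classes M \<longrightarrow>
     x * L x powr (-1 - \<epsilon>) \<le> real (card M) \<longrightarrow>
     (\<exists>q\<in>M. \<exists>q'\<in>M. q \<noteq> q' \<and> x * L x powr (-1 - 3 * \<epsilon>) \<le> real (gcd q q'))"
proof -
  define s where "s x = sqrt (ln x / ln (ln x))" for x :: real
  define l where "l x = sqrt (ln x * ln (ln x))" for x :: real
  have "\<forall>\<^sub>F x::real in at_top. ln (ln x) \<ge> 2" by real_asymp
  moreover have "\<forall>\<^sub>F x in at_top. s x * ln (1 + ln x) - 8 * s x * ln (s x) \<le> - 2 * l x - ln 4"
    unfolding s_def l_def by real_asymp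
  moreover have "\<forall>\<^sub>F x in at_top. 8 * s x + 2 \<le> ln x" unfolding s_def by real_asymp
  moreover have "\<forall>\<^sub>F x::real in at_top. 16 * (2 * ln (ln x) + 1) ^ 2 < ln (ln x) ^ 3" by real_asymp
  moreover have "\<forall>\<^sub>F x in at_top. (8 * s x + 1) * (4 * ln (ln (ln x))) +
      (8 * s x + 1 + 2 * (6 * l x + 1)) / ln (ln x) \<le> \<epsilon> * l x"
    unfolding s_def l_def using \<epsilon>(1) by real_asymp
  moreover have "\<forall>\<^sub>F x in at_top. (1 + 3 * \<epsilon>) * l x \<le> ln x" unfolding l_def using \<epsilon>(1) by real_asymp
  moreover have "\<forall>\<^sub>F x in at_top. ln 2 < \<epsilon> * l x" unfolding l_def using \<epsilon>(1) by real_asymp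
  moreover have "\<forall>\<^sub>F x in at_top. ln 4 \<le> l x" unfolding l_def by real_asymp
  moreover have "\<forall>\<^sub>F x in at_top. s x \<ge> 1" unfolding s_def by real_asymp
  ultimately show ?thesis using eventually_ge_at_top[of 1]
  proof eventually_elim
    case (elim x)
    note E = elim
    define N where "N = nat \<lfloor>x\<rfloor>"
    define w where "w = nat \<lceil>8 * s x\<rceil>"
    \<comment> \<open>The 6 gives 2^B \<ge> exp(B / 2) \<ge> exp(3 * l) \<ge> 4 * exp(2 * l), once l
      \<ge> ln 4.\<close>
    define B where "B = nat \<lceil>6 * l x\<rceil>"
    \<comment> \<open>The 2 gives 2^J \<ge> exp(J / 2) \<ge> ln x \<ge> w.\<close>
    define J where "J = nat \<lceil>2 * ln (ln x)\<rceil>"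
    have x1: "x \<ge> 1" using E by simp
    have N: "N \<ge> 1" "real N \<le> x" unfolding N_def using x1 by linarith+
    have l0: "l x > 0" using E(8) ln_gt_zero[of 4] by linarith
    have w: "8 * s x \<le> real w" "real w \<le> 8 * s x + 1" unfolding w_def using E(9) by linarith+
    have B: "6 * l x \<le> real B" "real B \<le> 6 * l x + 1" unfolding B_def using l0 by linarith+
    have J: "2 * ln (ln x) \<le> real J" "real J \<le> 2 * ln (ln x) + 1" unfolding J_def using E(1) by linarith+
    have xx: "exp (ln x) = x" using x1 by simp
    show ?case
    proof (intro allI impI)
      fix M assume M: "M \<subseteq> {q. 1 \<le> q \<and> real q \<le> x}" and adm: "admits_disjoint_classes M"
        and big: "x * L x powr (-1 - \<epsilon>) \<le> real (card M)"
      have MN: "M \<subseteq> {1..N}" using M by (auto simp: N_def le_nat_floor)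
      define B1 where "B1 = {n\<in>{1..N}. w \<le> card (prime_factors n)}"
      define B2 where "B2 = {n\<in>{1..N}. size (prime_factorization n) > card (prime_factors n) + 2 * B}"
      define M' where "M' = M - B1 - B2"
      have finM: "finite M" using MN finite_subset by blast
      have "real (card B1) \<le> x * exp (s x * ln (1 + ln x) - 8 * s x * ln (s x))"
        unfolding B1_def by (rule card_many_prime_factors_le_exp[OF N E(9) w(1)])
      also have "\<dots> \<le> x * exp (- 2 * l x - ln 4)" using E(2) x1 by (intro mult_left_mono) auto
      also have "\<dots> = x * exp (- 2 * l x) / 4" by (simp add: exp_diff)
      finally have c1: "real (card B1) \<le> x * exp (- 2 * l x) / 4" .
      have "exp (2 * l x + ln 4) \<le> exp (real B / 2)" using B(1) E(8) by simp
      also have "\<dots> \<le> 2 ^ B" by (rule exp_half_le_two_power)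
      finally have e2B: "4 * exp (2 * l x) \<le> 2 ^ B" by (simp add: exp_add)
      have "real (card B2) \<le> N / 2 ^ B" unfolding B2_def by (rule card_many_repeated_prime_factors_le)
      also have "\<dots> \<le> x / (4 * exp (2 * l x))" using N e2B by (intro frac_le) auto
      also have "\<dots> = x * exp (- 2 * l x) / 4" by (simp add: exp_minus field_simps)
      finally have c2: "real (card B2) \<le> x * exp (- 2 * l x) / 4" .
      have "card M \<le> card (M' \<union> (B1 \<union> B2))"
        unfolding M'_def using finM by (intro card_mono) (auto simp: B1_def B2_def)
      also have "\<dots> \<le> card M' + (card B1 + card B2)"
        by (meson add_left_mono card_Un_le order.trans)
      finally have "real (card M) \<le> real (card M') + real (card B1) + real (card B2)" by linarith
      moreover have "x * exp (- 2 * l x) \<le> x * exp (- (1 + \<epsilon>) * l x)"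
      proof -
        have "(1 + \<epsilon>) * l x \<le> 2 * l x" using \<epsilon> l0 by (intro mult_right_mono) auto
        then have "- 2 * l x \<le> - (1 + \<epsilon>) * l x" by (simp only: mult_minus_left neg_le_iff_le)
        then have "exp (- 2 * l x) \<le> exp (- (1 + \<epsilon>) * l x)" by (simp only: exp_le_cancel_iff)
        then show ?thesis using x1 by (intro mult_left_mono) simp_all
      qed
      moreover have "x * exp (- (1 + \<epsilon>) * l x) \<le> real (card M)"
        using big unfolding L_powr l_def[symmetric] by (simp add: algebra_simps)
      ultimately have M'big: "x * exp (- (1 + \<epsilon>) * l x) / 2 \<le> real (card M')" using c1 c2 by linarith
      show "\<exists>q\<in>M. \<exists>q'\<in>M. q \<noteq> q' \<and> x * L x powr (-1 - 3 * \<epsilon>) \<le> real (gcd q q')"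
      proof (rule ccontr)
        assume no: "\<not> ?thesis"
        define D where "D = x * L x powr (-1 - 3 * \<epsilon>)"
        define ll where "ll = ln (ln x)"
        have ll: "ll \<ge> 2" using E(1) by (simp add: ll_def)
        obtain a where a: "disjoint_family_on (\<lambda>m. residue_class (a m) m) M"
          using adm by (auto simp: admits_disjoint_classes_def)
        have Dexp: "D = exp (ln x - (1 + 3 * \<epsilon>) * l x)"
          unfolding D_def L_powr l_def[symmetric] exp_diff xx by (simp add: exp_minus algebra_simps divide_inverse flip: exp_minus)
        have "real (card M') \<le> D * exp (\<epsilon> * l x)"
        proof (rule card_le_max_gcd_times_weight)
          show "finite M'" using finM by (simp add: M'_def)
          show "q > 0" if "q \<in> M'" for q using that MN by (auto simp: M'_def)
          show "\<not> [a q = a q'] (mod int (gcd q q'))" if "q \<in> M'" "q' \<in> M'" "q \<noteq> q'" for q q'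
            using residue_classes_meet[of "a q" "a q'" q q'] a that by (auto simp: M'_def disjoint_family_on_def)
          show "real (gcd q q') \<le> D" if "q \<in> M'" "q' \<in> M'" "q \<noteq> q'" for q q'
            using no that unfolding M'_def D_def by fastforce
          have "real w \<le> ln x" using w(2) E(3) by linarith
          also have "ln x = exp (ln (ln x))" using E(3,9) by (subst exp_ln) auto
          also have "\<dots> \<le> exp (real J / 2)" using J by simp
          also have "\<dots> \<le> 2 ^ J" by (rule exp_half_le_two_power)
          finally have "real w \<le> real (2 ^ J)" by simp
          then have wJ: "w \<le> 2 ^ J" by (simp only: of_nat_le_iff)
          show "card (prime_factors q) < 2 ^ J" if "q \<in> M'" for q
            using that MN wJ by (auto simp: M'_def B1_def)
          \<comment> \<open>The choice E = 1 + 1 / ll, R = ll^4 gives R * (E - 1) = ll^3, which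
            beats 16 * J^2 of order ll^2. \<open>E\<close> must tend to 1: up to w + 2 * B factors
            of it occur, and B is of order l, so a fixed E > 1 would cost a power of L(x).\<close>
          show "(1::real) < 1 + 1 / ll" using ll by simp
          have "(real J)\<^sup>2 \<le> (2 * ln (ln x) + 1)\<^sup>2" using J(2) by (intro power_mono) auto
          then show "16 * (real J)\<^sup>2 < ll ^ 3" using E(4) unfolding ll_def by linarith
          show "1 \<le> ll ^ 4" using ll by (intro one_le_power) simp
          show "ll ^ 3 \<le> ll ^ 4 * (1 + 1 / ll - 1)" using ll by (simp add: power_numeral_reduce)
          show "1 \<le> exp (\<epsilon> * l x)" using \<epsilon> l0 by simp
          show "1 \<le> D" unfolding Dexp using E(6) by simp
          fix q assume q: "q \<in> M'"
          then have q1: "card (prime_factors q) \<le> w" and q2: "size (prime_factorization q) \<le> w + 2 * B"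
            using MN by (auto simp: M'_def B1_def B2_def)
          have "(ll ^ 4) ^ card (prime_factors q) \<le> (ll ^ 4) ^ w"
            using q1 \<open>1 \<le> ll ^ 4\<close> by (intro power_increasing)
          also have "\<dots> = exp (real w * (4 * ln ll))"
          proof -
            have "exp (4 * ln ll) = ll ^ 4" using exp_of_nat_mult[of 4 "ln ll"] ll by simp
            then show ?thesis by (simp add: exp_of_nat_mult)
          qed
          finally have p1: "(ll ^ 4) ^ card (prime_factors q) \<le> exp (real w * (4 * ln ll))" .
          have "(1 + 1 / ll) ^ size (prime_factorization q) \<le> (1 + 1 / ll) ^ (w + 2 * B)"
            using q2 ll by (intro power_increasing) auto
          also have "\<dots> \<le> exp (1 / ll) ^ (w + 2 * B)"
            using ll by (intro power_mono exp_ge_add_one_self) auto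
          also have "\<dots> = exp ((real w + 2 * real B) / ll)" by (simp flip: exp_of_nat_mult)
          finally have p2: "(1 + 1 / ll) ^ size (prime_factorization q) \<le> exp ((real w + 2 * real B) / ll)" .
          have "prime_weight (ll ^ 4) (1 + 1 / ll) q \<le> exp (real w * (4 * ln ll)) * exp ((real w + 2 * real B) / ll)"
            unfolding prime_weight_def using p1 p2 ll by (intro mult_mono) auto
          also have "\<dots> = exp (real w * (4 * ln ll) + (real w + 2 * real B) / ll)" by (simp add: exp_add)
          also have "\<dots> \<le> exp (\<epsilon> * l x)"
          proof -
            have "real w * (4 * ln ll) \<le> (8 * s x + 1) * (4 * ln ll)"
              using w(2) ll by (intro mult_right_mono) auto
            moreover have "(real w + 2 * real B) / ll \<le> (8 * s x + 1 + 2 * (6 * l x + 1)) / ll"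
              using w(2) B(2) ll by (intro divide_right_mono) auto
            ultimately show ?thesis using E(5) unfolding ll_def by simp
          qed
          finally show "prime_weight (ll ^ 4) (1 + 1 / ll) q \<le> exp (\<epsilon> * l x)" .
        qed
        also have "\<dots> = exp (ln x - (1 + 2 * \<epsilon>) * l x)"
          unfolding Dexp by (simp add: algebra_simps flip: exp_add)
        finally have up: "real (card M') \<le> exp (ln x - (1 + 2 * \<epsilon>) * l x)" .
        have "exp (ln x - (1 + \<epsilon>) * l x) = exp (ln x + - (1 + \<epsilon>) * l x)" by (simp add: algebra_simps)
        also have "\<dots> = x * exp (- (1 + \<epsilon>) * l x)" by (simp only: exp_add xx)
        finally have "exp (ln x - (1 + \<epsilon>) * l x) / 2 \<le> exp (ln x - (1 + 2 * \<epsilon>) * l x)"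
          using M'big up by linarith
        then have "exp (ln x - (1 + \<epsilon>) * l x) \<le> exp (ln 2 + (ln x - (1 + 2 * \<epsilon>) * l x))"
          by (simp add: exp_add)
        then have "\<epsilon> * l x \<le> ln 2" by (simp add: algebra_simps)
        then show False using E(7) by simp
      qed
    qed
  qed
qed

section \<open>Lower bound for the extremal function\<close>

lemma prod_powers_Suc_square: "(\<Prod>i<K. (\<rho>::real) ^ Suc i)\<^sup>2 = \<rho> ^ (K * (K + 1))"
  by (induction K) (simp_all add: power_mult_distrib power2_eq_square power_add algebra_simps)

lemma eventually_max_disjoint_classes_ge:
  fixes \<epsilon> :: real
  assumes \<epsilon>: "0 < \<epsilon>" "\<epsilon> \<le> 1 / 2"
  shows "\<forall>\<^sub>F x in at_top. x * L x powr (-1 - 2 * \<epsilon>) \<le> real (max_disjoint_classes x)"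
proof -
  define s where "s x = sqrt (ln x / ln (ln x))" for x :: real
  define l where "l x = sqrt (ln x * ln (ln x))" for x :: real
  \<comment> \<open>Dividing 2 * s by 1 + \<epsilon> raises ln \<rho> to at least (1 + \<epsilon>) /
    2 * ln (ln x), so \<rho> exceeds l, while the loss exp(2 * ln x / t) is only exp((1 +
    \<epsilon>) * l).\<close>
  define t where "t x = 2 * s x / (1 + \<epsilon>)" for x
  obtain y0 where y0: "\<And>y::real. y \<ge> y0 \<Longrightarrow>
      y / (4 * ln y) \<le> real (card {p::nat. prime p \<and> y / 16 < p \<and> p \<le> y})"
    using eventually_card_primes_ge unfolding eventually_at_top_linorder by blast
  have "\<forall>\<^sub>F x in at_top. l x \<le> \<epsilon> * ln x"
    unfolding l_def using \<epsilon>(1) by real_asymp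
  moreover have "\<forall>\<^sub>F x::real in at_top. max 32 y0 \<le> exp ((1 + \<epsilon>) / 2 * ln (ln x))"
  proof -
    have "filterlim (\<lambda>x::real. exp ((1 + \<epsilon>) / 2 * ln (ln x))) at_top at_top"
      using \<epsilon>(1) by real_asymp
    then show ?thesis unfolding filterlim_at_top by blast
  qed
  moreover have "\<forall>\<^sub>F x in at_top. l x \<le> exp ((1 + \<epsilon>) / 2 * ln (ln x))"
    unfolding l_def using \<epsilon>(1) by real_asymp
  moreover have "\<forall>\<^sub>F x in at_top. 2 * ln 32 * s x + (1 + \<epsilon>) * l x \<le> (1 + 2 * \<epsilon>) * l x"
    unfolding s_def l_def using \<epsilon>(1) by real_asymp
  moreover have "\<forall>\<^sub>F x in at_top. s x \<ge> 4" unfolding s_def by real_asymp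
  moreover have "\<forall>\<^sub>F x::real in at_top. ln x \<ge> 2" by real_asymp
  ultimately show ?thesis using eventually_ge_at_top[of 3]
  proof eventually_elim
    case (elim x)
    note E = elim
    have lx: "ln x > 0" "ln (ln x) > 0" "x > 0" using E by auto
    have ls: "l x = s x * ln (ln x)" "s x * l x = ln x" "s x * s x * ln (ln x) = ln x"
    proof -
      have "l x = sqrt (ln x / ln (ln x) * (ln (ln x))\<^sup>2)"
        unfolding l_def using lx by (simp add: power2_eq_square)
      also have "\<dots> = s x * ln (ln x)" unfolding s_def real_sqrt_mult using lx by simp
      finally show 1: "l x = s x * ln (ln x)" .
      have "s x * s x = ln x / ln (ln x)" using lx by (simp add: s_def)
      then show 2: "s x * s x * ln (ln x) = ln x" using lx by simp
      then show "s x * l x = ln x" unfolding 1 by (simp add: mult.assoc)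
    qed
    define K where "K = nat \<lfloor>t x\<rfloor>"
    \<comment> \<open>The exponents 1, ..., K sum to K * (K + 1) / 2, so for this real \<rho> the
      upper ends of the blocks multiply to exactly \<open>x\<close>.\<close>
    define \<rho> where "\<rho> = x powr (2 / (real K * (real K + 1)))"
    have t0: "t x \<ge> 0" using E(5) \<epsilon> by (simp add: t_def)
    have K: "real K \<le> t x" "t x < real K + 1" using t0 unfolding K_def by linarith+
    have "t x \<le> 2 * s x" using E(5) \<epsilon> by (simp add: t_def divide_le_eq)
    have "(4 / 3) * s x \<le> t x" using E(5) \<epsilon> by (simp add: t_def le_divide_eq)
    then have sK: "s x \<le> real K" using K E(5) by linarith
    have K2s: "real K \<le> 2 * s x" using K \<open>t x \<le> 2 * s x\<close> by linarith
    have K1: "K \<ge> 1" using sK E(5) by linarith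
    have kk: "real K * (real K + 1) > 0" using K1 by (intro mult_pos_pos) auto
    have ln\<rho>: "ln \<rho> = 2 * ln x / (real K * (real K + 1))" unfolding \<rho>_def using lx by simp
    have "(1 + \<epsilon>) / 2 * ln (ln x) * (real K * (real K + 1)) \<le> (1 + \<epsilon>) / 2 * ln (ln x) * (t x * (t x + 1))"
      using K lx \<epsilon> t0 by (intro mult_left_mono mult_mono) auto
    also have "\<dots> = 2 / (1 + \<epsilon>) * (s x * s x * ln (ln x)) + s x * ln (ln x)"
    proof -
      have "c / 2 * b * (2 * a / c * (2 * a / c + 1)) = 2 / c * (a * a * b) + a * b"
        if "c \<noteq> 0" for a b c :: real
        using that by (simp add: field_simps)
      then show ?thesis unfolding t_def using \<epsilon> by simp
    qed
    also have "\<dots> = 2 / (1 + \<epsilon>) * ln x + l x" unfolding ls(3) ls(1) ..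
    also have "\<dots> \<le> 2 * ln x"
    proof -
      have "\<epsilon> * \<epsilon> \<le> \<epsilon> * 1" using \<epsilon> by (intro mult_left_mono) auto
      then have "2 + \<epsilon> * (1 + \<epsilon>) \<le> 2 * (1 + \<epsilon>)" by (simp add: algebra_simps)
      then have "2 / (1 + \<epsilon>) + \<epsilon> \<le> 2" using \<epsilon> by (simp add: field_simps)
      then have "(2 / (1 + \<epsilon>) + \<epsilon>) * ln x \<le> 2 * ln x" using lx by (intro mult_right_mono) auto
      then show ?thesis using E(1) by (simp add: distrib_right)
    qed
    finally have low: "(1 + \<epsilon>) / 2 * ln (ln x) \<le> ln \<rho>" unfolding ln\<rho> using kk by (simp add: le_divide_eq)
    have \<rho>0: "\<rho> > 0" using lx by (simp add: \<rho>_def)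
    have low': "exp ((1 + \<epsilon>) / 2 * ln (ln x)) \<le> \<rho>" using low \<rho>0 ln_ge_iff by blast
    have \<rho>32: "\<rho> \<ge> 32" "\<rho> \<ge> y0" and \<rho>l: "l x \<le> \<rho>" using E(2,3) low' by auto
    have "s x * s x \<le> real K * (real K + 1)" using sK E(5) by (intro mult_mono) auto
    then have "ln \<rho> \<le> 2 * ln x / (s x * s x)"
      unfolding ln\<rho> using lx E(5) by (intro divide_left_mono mult_pos_pos[OF kk]) auto
    also have "\<dots> = 2 * ln (ln x)" using ls(3) E(5) by (simp add: field_simps)
    finally have up: "ln \<rho> \<le> 2 * ln (ln x)" .
    have "real K * ln \<rho> \<le> (2 * s x) * (2 * ln (ln x))"
      using K2s up \<rho>32 E(5) by (intro mult_mono) auto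
    also have "\<dots> = 4 * l x" using ls(1) by simp
    \<comment> \<open>This bounds the logarithm of every block end by 4 * \<rho>. With the 4 in the
      prime count it gives the density constant 1 / 16.\<close>
    finally have Kl: "real K * ln \<rho> \<le> 4 * \<rho>" using \<rho>l by linarith
    have xprod: "x = (\<Prod>i<K. \<rho> ^ Suc i)"
    proof (rule power2_eq_imp_eq)
      have "\<rho> ^ (K * (K + 1)) = \<rho> powr (real K * (real K + 1))"
        using powr_realpow[OF \<rho>0, of "K * (K + 1)"] by (simp add: algebra_simps)
      also have "\<dots> = x powr 2" 
      proof -
        have "2 / (real K * (real K + 1)) * (real K * (real K + 1)) = 2"
          using kk nonzero_eq_divide_eq[of "real K * (real K + 1)"] by (metis less_irrefl)
        then show ?thesis unfolding \<rho>_def powr_powr by simp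
      qed
      also have "\<dots> = x\<^sup>2" using lx by (simp add: powr_numeral)
      finally show "x\<^sup>2 = (\<Prod>i<K. \<rho> ^ Suc i)\<^sup>2" unfolding prod_powers_Suc_square by simp
    qed (use lx \<rho>0 in \<open>auto intro!: prod_nonneg\<close>)
    have "x / (32 * \<rho>) ^ K \<le> real (max_disjoint_classes x)"
    proof (rule max_disjoint_classes_ge_of_prime_density[OF K1 \<rho>32(1) xprod])
      fix i assume i: "i < K"
      have r1: "\<rho> \<le> \<rho> ^ Suc i" using \<rho>32 by (intro self_le_power) auto
      have "real (Suc i) * ln \<rho> \<le> real K * ln \<rho>" using i \<rho>32 by (intro mult_right_mono) auto
      then have lp: "ln (\<rho> ^ Suc i) \<le> 4 * \<rho>" using Kl \<rho>0 by (simp add: ln_realpow del: power_Suc)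
      have lpos: "ln (\<rho> ^ Suc i) > 0" using r1 \<rho>32 by (intro ln_gt_zero) linarith
      have "1 / 16 * \<rho> ^ i = \<rho> ^ Suc i / (4 * (4 * \<rho>))" using \<rho>0 by simp
      also have "\<dots> \<le> \<rho> ^ Suc i / (4 * ln (\<rho> ^ Suc i))"
        using lp lpos \<rho>0 by (intro divide_left_mono mult_pos_pos) auto
      also have "\<dots> \<le> card {p::nat. prime p \<and> \<rho> ^ Suc i / 16 < p \<and> p \<le> \<rho> ^ Suc i}"
        using r1 \<rho>32 by (intro y0) linarith
      finally show "1 / 16 * \<rho> ^ i \<le> card {p::nat. prime p \<and> \<rho> ^ Suc i / 16 < p \<and> p \<le> \<rho> ^ Suc i}" .
    qed
    moreover have "x * L x powr (-1 - 2 * \<epsilon>) \<le> x / (32 * \<rho>) ^ K"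
    proof -
      have "ln ((32 * \<rho>) ^ K) = real K * ln 32 + real K * ln \<rho>"
        using \<rho>0 by (simp add: ln_realpow ln_mult distrib_left)
      also have "real K * ln \<rho> = 2 * ln x / (real K + 1)" unfolding ln\<rho> using K1 by simp
      also have "\<dots> \<le> 2 * ln x / t x" using K lx E(5) \<open>4 / 3 * s x \<le> t x\<close> by (intro divide_left_mono) auto
      also have "\<dots> = (1 + \<epsilon>) * l x" unfolding t_def ls(2)[symmetric] using E(5) \<epsilon> by (simp add: field_simps)
      also have "real K * ln 32 \<le> 2 * s x * ln 32" using K2s by (intro mult_right_mono) auto
      also have "2 * s x * ln 32 + (1 + \<epsilon>) * l x \<le> (1 + 2 * \<epsilon>) * l x" using E(4) by (simp add: mult_ac)
      finally have "exp (ln ((32 * \<rho>) ^ K)) \<le> exp ((1 + 2 * \<epsilon>) * l x)" by simp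
      then have "(32 * \<rho>) ^ K \<le> exp ((1 + 2 * \<epsilon>) * l x)" using \<rho>0 by (subst (asm) exp_ln) auto
      then have "x / exp ((1 + 2 * \<epsilon>) * l x) \<le> x / (32 * \<rho>) ^ K"
        using lx \<rho>0 by (intro divide_left_mono) auto
      moreover have "x / exp ((1 + 2 * \<epsilon>) * l x) = x * exp (- ((1 + 2 * \<epsilon>) * l x))"
        by (simp only: exp_minus divide_inverse)
      moreover have "- ((1 + 2 * \<epsilon>) * l x) = (-1 - 2 * \<epsilon>) * l x" by (simp add: algebra_simps)
      ultimately show ?thesis unfolding L_powr l_def[symmetric] by simp
    qed
    ultimately show ?case by linarith
  qed
qed

section \<open>From every fixed \<epsilon> to o(1)\<close>

lemma large_gcd_conclusions:
  assumes Q: "\<forall>\<^sub>F x in at_top. Q x \<subseteq> {q. 1 \<le> q \<and> real q \<le> x}"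
    and gcd: "\<And>\<epsilon>. 0 < \<epsilon> \<Longrightarrow> \<forall>\<^sub>F x in at_top.
      \<exists>q\<in>Q x. \<exists>q'\<in>Q x. q \<noteq> q' \<and> x * L x powr (-1 - \<epsilon>) \<le> real (gcd q q')"
  shows "large_max_gcd Q \<and> has_close_pair Q"
proof -
  define A where "A x = {gcd q q' | q q'. q \<in> Q x \<and> q' \<in> Q x \<and> q \<noteq> q'}" for x
  define l where "l x = sqrt (ln x * ln (ln x))" for x :: real
  \<comment> \<open>Without the truncation this would be the exact exponent of the maximum. Only
    lower bounds for the gcd are available, so \<open>min 0\<close> is what makes the limit 0
    follow.\<close>
  define \<delta> where "\<delta> x = min 0 (ln (real (Max (A x)) / x) / l x + 1)" for x
  have l: "\<forall>\<^sub>F x in at_top. l x > 0" unfolding l_def by real_asymp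
  have fin: "finite (A x)" if "Q x \<subseteq> {q. 1 \<le> q \<and> real q \<le> x}" for x
  proof -
    have "Q x \<subseteq> {..nat \<lfloor>x\<rfloor>}" using that by (auto simp: le_nat_floor)
    then have "finite (Q x)" using finite_subset by blast
    then have "finite ((\<lambda>(q, q'). gcd q q') ` (Q x \<times> Q x))" by simp
    then show ?thesis by (rule rev_finite_subset) (auto simp: A_def)
  qed
  have low: "\<forall>\<^sub>F x in at_top. x * L x powr (-1 + \<delta> x) \<le> real (Max (A x)) \<and> Max (A x) \<in> A x"
    using Q gcd[OF zero_less_one] l eventually_gt_at_top[of 0]
  proof eventually_elim
    case (elim x)
    have "A x \<noteq> {}" using elim(2) unfolding A_def by auto
    then have MA: "Max (A x) \<in> A x" using fin[OF elim(1)] by simp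
    then obtain q q' where q: "Max (A x) = gcd q q'" "q \<in> Q x" by (auto simp: A_def)
    then have "q > 0" using elim(1) by auto
    then have g0: "real (Max (A x)) > 0" unfolding q by simp
    have "(-1 + \<delta> x) * l x \<le> ln (real (Max (A x)) / x) / l x * l x"
      using elim(3) by (intro mult_right_mono) (auto simp: \<delta>_def)
    also have "\<dots> = ln (real (Max (A x)) / x)" using elim(3) by simp
    finally have "exp ((-1 + \<delta> x) * l x) \<le> real (Max (A x)) / x"
      using g0 elim(4) ln_ge_iff[of "real (Max (A x)) / x"] by simp
    then show ?case using MA elim(4) by (simp add: L_powr l_def pos_le_divide_eq mult.commute)
  qed
  have lim: "(\<delta> \<longlongrightarrow> 0) at_top"
  proof (rule tendstoI)
    fix e :: real assume e: "e > 0"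
    show "\<forall>\<^sub>F x in at_top. dist (\<delta> x) 0 < e"
      using Q gcd[OF half_gt_zero[OF e]] l eventually_gt_at_top[of 0]
    proof eventually_elim
      case (elim x)
      obtain q q' where q: "q \<in> Q x" "q' \<in> Q x" "q \<noteq> q'"
        and b: "x * L x powr (-1 - e / 2) \<le> real (gcd q q')" using elim(2) by blast
      have "gcd q q' \<le> Max (A x)" using fin[OF elim(1)] q by (intro Max_ge) (auto simp: A_def)
      then have "real (gcd q q') \<le> real (Max (A x))" by simp
      with b have "x * exp ((-1 - e / 2) * l x) \<le> real (Max (A x))" by (simp add: L_powr l_def)
      then have "exp ((-1 - e / 2) * l x) \<le> real (Max (A x)) / x"
        using elim(4) by (simp add: pos_le_divide_eq mult.commute)
      moreover from this have "real (Max (A x)) / x > 0" by (meson exp_gt_zero less_le_trans)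
      ultimately have "(-1 - e / 2) * l x \<le> ln (real (Max (A x)) / x)" using ln_ge_iff by blast
      then have "-1 - e / 2 \<le> ln (real (Max (A x)) / x) / l x" using elim(3) by (simp add: pos_le_divide_eq)
      then show ?case using e by (auto simp: \<delta>_def dist_real_def)
    qed
  qed
  have "large_max_gcd Q"
    unfolding large_max_gcd_def A_def[symmetric]
    using lim low by (intro exI[of _ \<delta>]) (auto elim: eventually_mono)
  moreover have "has_close_pair Q"
    unfolding has_close_pair_def
  \<comment> \<open>For the pair attaining the maximum, g * u \<le> x and g * v \<le> x. The lower
    bound for \<open>g\<close> thus turns into an upper bound for the cofactors with the opposite
    error term.\<close>
  proof (rule exI[of _ \<delta>], rule exI[of _ "\<lambda>x. - \<delta> x"], intro conjI)
    show "((\<lambda>x. - \<delta> x) \<longlongrightarrow> 0) at_top" using tendsto_minus[OF lim] by simp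
    show "\<forall>\<^sub>F x in at_top.
          \<exists>q \<in> Q x. \<exists>q' \<in> Q x. \<exists>g u v :: nat.
            q \<noteq> q' \<and> g > 0 \<and> u > 0 \<and> v > 0 \<and>
            q = g * u \<and> q' = g * v \<and> gcd u v = 1 \<and>
            real g \<ge> x * L x powr (-1 + \<delta> x) \<and>
            real (max u v) \<le> L x powr (1 + - \<delta> x)"
      using Q low eventually_gt_at_top[of 0]
    proof eventually_elim
      case (elim x)
      then obtain q q' where q: "q \<in> Q x" "q' \<in> Q x" "q \<noteq> q'" "Max (A x) = gcd q q'"
        by (auto simp: A_def)
      define g where "g = gcd q q'"
      obtain u v where uv: "q = g * u" "q' = g * v" unfolding g_def by (meson dvdE gcd_dvd1 gcd_dvd2)
      have qx: "q > 0" "real q \<le> x" "q' > 0" "real q' \<le> x" using q elim(1) by auto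
      have g: "real g \<ge> x * L x powr (-1 + \<delta> x)" using elim(2) q(4) by (simp add: g_def)
      have g0: "g > 0" "u > 0" "v > 0" using uv qx by (auto intro: Nat.gr0I)
      have "g * gcd u v = g" using uv unfolding g_def by (metis gcd_mult_distrib_nat)
      then have "gcd u v = 1" using g0 by simp
      have bound: "real w \<le> L x powr (1 + - \<delta> x)" if "real (g * w) \<le> x" for w
      proof -
        have p: "L x powr (-1 + \<delta> x) > 0" by (simp add: L_def)
        have "(x * L x powr (-1 + \<delta> x)) * real w \<le> real g * real w"
          using g by (intro mult_right_mono) auto
        also have "\<dots> \<le> x * 1" using that by simp
        finally have "L x powr (-1 + \<delta> x) * real w \<le> 1" using elim(3) by (simp add: mult.assoc)
        then have "real w \<le> 1 / L x powr (-1 + \<delta> x)" using p by (simp add: pos_le_divide_eq mult.commute)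
        also have "\<dots> = L x powr (1 + - \<delta> x)" using powr_minus_divide[of "L x" "-1 + \<delta> x"] by simp
        finally show ?thesis .
      qed
      have "real (max u v) \<le> L x powr (1 + - \<delta> x)"
        using bound[of u] bound[of v] qx uv by (simp add: max_def)
      then have "q \<noteq> q' \<and> g > 0 \<and> u > 0 \<and> v > 0 \<and> q = g * u \<and> q' = g * v \<and> gcd u v = 1 \<and>
          real g \<ge> x * L x powr (-1 + \<delta> x) \<and> real (max u v) \<le> L x powr (1 + - \<delta> x)"
        by (intro conjI q(3) g0 uv \<open>gcd u v = 1\<close> g)
      then show ?case
        by - (rule bexI[OF _ q(1)], rule bexI[OF _ q(2)], rule exI[of _ g], rule exI[of _ u], rule exI[of _ v])
    qed
  qed (rule lim)
  ultimately show ?thesis by simp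
qed

lemma large_gcd_conclusions_of_card:
  assumes Q: "\<forall>\<^sub>F x in at_top. Q x \<subseteq> {q. 1 \<le> q \<and> real q \<le> x} \<and> admits_disjoint_classes (Q x)"
    and card: "\<And>\<epsilon>. 0 < \<epsilon> \<Longrightarrow> \<epsilon> \<le> 1 \<Longrightarrow> \<forall>\<^sub>F x in at_top. x * L x powr (-1 - \<epsilon>) \<le> real (card (Q x))"
  shows "large_max_gcd Q \<and> has_close_pair Q"
proof (rule large_gcd_conclusions)
  show "\<forall>\<^sub>F x in at_top. Q x \<subseteq> {q. 1 \<le> q \<and> real q \<le> x}" using Q by (auto elim: eventually_mono)
  fix \<epsilon> :: real assume \<epsilon>: "0 < \<epsilon>"
  \<comment> \<open>The gcd bound loses three times its parameter and asks for a parameter at most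
    1.\<close>
  define \<eta> where "\<eta> = min 1 (\<epsilon> / 3)"
  have \<eta>: "0 < \<eta>" "\<eta> \<le> 1" "3 * \<eta> \<le> \<epsilon>" using \<epsilon> by (auto simp: \<eta>_def)
  have L1: "\<forall>\<^sub>F x in at_top. L x \<ge> 1" unfolding L_def by real_asymp
  show "\<forall>\<^sub>F x in at_top. \<exists>q\<in>Q x. \<exists>q'\<in>Q x. q \<noteq> q' \<and> x * L x powr (-1 - \<epsilon>) \<le> real (gcd q q')"
    using Q card[OF \<eta>(1,2)] eventually_exists_large_gcd[OF \<eta>(1,2)] L1 eventually_gt_at_top[of 0]
  proof eventually_elim
    case (elim x)
    then obtain q q' where q: "q \<in> Q x" "q' \<in> Q x" "q \<noteq> q'" "x * L x powr (-1 - 3 * \<eta>) \<le> real (gcd q q')"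
      by blast
    have "x * L x powr (-1 - \<epsilon>) \<le> x * L x powr (-1 - 3 * \<eta>)"
      using elim(4,5) \<eta>(3) by (intro mult_left_mono powr_mono) auto
    then show ?case using q by (meson order.trans)
  qed
qed

theorem corollary1p2:
  fixes Q :: "real \<Rightarrow> nat set"
  assumes "\<forall>\<^sub>F x in at_top. Q x \<subseteq> {q. 1 \<le> q \<and> real q \<le> x} \<and> admits_disjoint_classes (Q x)"
  shows "((\<exists>\<delta> :: real \<Rightarrow> real. (\<delta> \<longlongrightarrow> 0) at_top \<and>
             (\<forall>\<^sub>F x in at_top. real (card (Q x)) = x * L x powr (-1 + \<delta> x)))
            \<longrightarrow> large_max_gcd Q \<and> has_close_pair Q)
       \<and> ((\<forall>\<^sub>F x in at_top. Q x \<subseteq> {q. 2 \<le> q \<and> real q \<le> x} \<and>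
             card (Q x) = max_disjoint_classes x)
            \<longrightarrow> large_max_gcd Q \<and> has_close_pair Q)"
proof (rule conjI; rule impI)
  assume "\<exists>\<delta> :: real \<Rightarrow> real. (\<delta> \<longlongrightarrow> 0) at_top \<and>
      (\<forall>\<^sub>F x in at_top. real (card (Q x)) = x * L x powr (-1 + \<delta> x))"
  then obtain \<delta> :: "real \<Rightarrow> real" where lim: "(\<delta> \<longlongrightarrow> 0) at_top"
    and card: "\<forall>\<^sub>F x in at_top. real (card (Q x)) = x * L x powr (-1 + \<delta> x)" by blast
  show "large_max_gcd Q \<and> has_close_pair Q"
  proof (rule large_gcd_conclusions_of_card[OF assms])
    fix \<epsilon> :: real assume \<epsilon>: "0 < \<epsilon>"
    have L1: "\<forall>\<^sub>F x in at_top. L x \<ge> 1" unfolding L_def by real_asymp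
    have "\<forall>\<^sub>F x in at_top. \<delta> x > - \<epsilon>" using order_tendstoD(1)[OF lim, of "- \<epsilon>"] \<epsilon> by simp
    then show "\<forall>\<^sub>F x in at_top. x * L x powr (-1 - \<epsilon>) \<le> real (card (Q x))"
      using card L1 eventually_gt_at_top[of 0]
    proof eventually_elim
      case (elim x)
      have "x * L x powr (-1 - \<epsilon>) \<le> x * L x powr (-1 + \<delta> x)"
        using elim by (intro mult_left_mono powr_mono) auto
      then show ?case using elim(2) by simp
    qed
  qed
next
  assume ext: "\<forall>\<^sub>F x in at_top. Q x \<subseteq> {q. 2 \<le> q \<and> real q \<le> x} \<and> card (Q x) = max_disjoint_classes x"
  show "large_max_gcd Q \<and> has_close_pair Q"
  proof (rule large_gcd_conclusions_of_card[OF assms])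
    fix \<epsilon> :: real assume \<epsilon>: "0 < \<epsilon>" "\<epsilon> \<le> 1"
    \<comment> \<open>The bound for extremal families loses twice its parameter, hence the
      half.\<close>
    then have "0 < \<epsilon> / 2" "\<epsilon> / 2 \<le> 1 / 2" by auto
    from eventually_max_disjoint_classes_ge[OF this] ext
    show "\<forall>\<^sub>F x in at_top. x * L x powr (-1 - \<epsilon>) \<le> real (card (Q x))"
      by eventually_elim simp
  qed
qed

end
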